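(* For any group $G$, the following two assertions are equivalent. (i) $G$ is amenable. (ii) For any ring $R$, the ring $T(G,R)$ has UGN if and only if $R$ has UGN.
   Context: Rings are unital; "module" means right module. A ring $S$ has unbounded generating number (UGN) if, for every positive integer $n$, there is no $S$-module epimorphism $S^n\to S^{n+1}$. A group $G$ is amenable if there is a function $\mu:\mathcal P(G)\to[0,\infty]$ such that $\mu(A\cup B)=\mu(A)+\mu(B)$ for all disjoint $A,B\subseteq G$, $\mu(gA)=\mu(A)$ for all $A\subseteq G$ and $g\in G$, and $\mu(G)=1$. For a ring $R$ and group $G$, the translation ring $T(G,R)$ is the ring of all $G\times G$ matrices $M$ over $R$ (functions $M:G\times G\to R$) for which there is a finite set $K\subseteq G$ such that $M(x,y)=0$ whenever $y\notin Kx$, with entrywise addition and the product $(MN)(x,y)=\sum_{z\in G}M(x,z)N(z,y)$ (a sum with only finitely many nonzero terms). *)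

theory Defs
  imports "HOL-Algebra.Coset" "HOL-Algebra.Ring" "HOL-Library.Extended_Nonnegative_Real"
begin

definition amenable :: "('g, 'b) monoid_scheme \<Rightarrow> bool" where
  "amenable G \<longleftrightarrow> (\<exists>\<mu> :: 'g set \<Rightarrow> ennreal.
     (\<forall>A B. A \<subseteq> carrier G \<longrightarrow> B \<subseteq> carrier G \<longrightarrow> A \<inter> B = {} \<longrightarrow> \<mu> (A \<union> B) = \<mu> A + \<mu> B) \<and>
     (\<forall>A. A \<subseteq> carrier G \<longrightarrow> (\<forall>g\<in>carrier G. \<mu> (g <#\<^bsub>G\<^esub> A) = \<mu> A)) \<and>
     \<mu> (carrier G) = 1)"

text \<open>
  The library's modules are restricted to commutative rings, so the free right module
  \<open>S\<^sup>n\<close> over a possibly non-commutative ring is given here as the set of \<open>n\<close>-tuples over \<open>S\<close>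
  (extensional functions on \<open>{..<n}\<close>) with componentwise addition and right scalar multiplication.
\<close>

definition free_carrier :: "('s, 'b) ring_scheme \<Rightarrow> nat \<Rightarrow> (nat \<Rightarrow> 's) set" where
  "free_carrier S n = ({..<n} \<rightarrow>\<^sub>E carrier S)"

definition free_add :: "('s, 'b) ring_scheme \<Rightarrow> nat \<Rightarrow> (nat \<Rightarrow> 's) \<Rightarrow> (nat \<Rightarrow> 's) \<Rightarrow> (nat \<Rightarrow> 's)" where
  "free_add S n v w = (\<lambda>i\<in>{..<n}. v i \<oplus>\<^bsub>S\<^esub> w i)"

definition free_rscale :: "('s, 'b) ring_scheme \<Rightarrow> nat \<Rightarrow> (nat \<Rightarrow> 's) \<Rightarrow> 's \<Rightarrow> (nat \<Rightarrow> 's)" where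
  "free_rscale S n v s = (\<lambda>i\<in>{..<n}. v i \<otimes>\<^bsub>S\<^esub> s)"

definition free_right_hom ::
  "('s, 'b) ring_scheme \<Rightarrow> nat \<Rightarrow> nat \<Rightarrow> ((nat \<Rightarrow> 's) \<Rightarrow> (nat \<Rightarrow> 's)) set" where
  "free_right_hom S m n = {f \<in> free_carrier S m \<rightarrow> free_carrier S n.
     (\<forall>v\<in>free_carrier S m. \<forall>w\<in>free_carrier S m. f (free_add S m v w) = free_add S n (f v) (f w)) \<and>
     (\<forall>v\<in>free_carrier S m. \<forall>s\<in>carrier S. f (free_rscale S m v s) = free_rscale S n (f v) s)}"

definition UGN :: "('s, 'b) ring_scheme \<Rightarrow> bool" where
  "UGN S \<longleftrightarrow> (\<forall>n>0. \<not> (\<exists>f\<in>free_right_hom S n (n + 1).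
     f ` free_carrier S n = free_carrier S (n + 1)))"

definition translation_carrier ::
  "('g, 'b) monoid_scheme \<Rightarrow> ('r, 'c) ring_scheme \<Rightarrow> ('g \<times> 'g \<Rightarrow> 'r) set" where
  "translation_carrier G R = {M \<in> carrier G \<times> carrier G \<rightarrow>\<^sub>E carrier R.
     \<exists>K. finite K \<and> K \<subseteq> carrier G \<and>
       (\<forall>x\<in>carrier G. \<forall>y\<in>carrier G. y \<notin> K #>\<^bsub>G\<^esub> x \<longrightarrow> M (x, y) = \<zero>\<^bsub>R\<^esub>)}"

text \<open>
  The sum defining a matrix product is taken over its support, which is finite: \<open>finsum\<close> over an
  infinite index set is zero by convention, even when only finitely many terms are nonzero.
\<close>

definition translation_ring ::
  "('g, 'b) monoid_scheme \<Rightarrow> ('r, 'c) ring_scheme \<Rightarrow> ('g \<times> 'g \<Rightarrow> 'r) ring" where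
  "translation_ring G R =
     \<lparr>carrier = translation_carrier G R,
      mult = (\<lambda>M N. \<lambda>(x, y)\<in>carrier G \<times> carrier G.
        \<Oplus>\<^bsub>R\<^esub>z\<in>{z \<in> carrier G. M (x, z) \<otimes>\<^bsub>R\<^esub> N (z, y) \<noteq> \<zero>\<^bsub>R\<^esub>}. M (x, z) \<otimes>\<^bsub>R\<^esub> N (z, y)),
      one = (\<lambda>(x, y)\<in>carrier G \<times> carrier G. if x = y then \<one>\<^bsub>R\<^esub> else \<zero>\<^bsub>R\<^esub>),
      zero = (\<lambda>p\<in>carrier G \<times> carrier G. \<zero>\<^bsub>R\<^esub>),
      add = (\<lambda>M N. \<lambda>p\<in>carrier G \<times> carrier G. M p \<oplus>\<^bsub>R\<^esub> N p)\<rparr>"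

end

theory Submission
  imports Defs "HOL-Analysis.Function_Topology"
begin

text \<open>
  The link between the two assertions is a quantitative failure of the Foelner condition. Call \<open>G\<close>
  expanding with constants \<open>K\<close> and \<open>n\<close>, for a finite \<open>K \<subseteq> G\<close> and a natural number \<open>n\<close>, if
  \<open>(n + 1) * card F \<le> n * card (K F)\<close> for every finite \<open>F \<subseteq> G\<close>. By Hall's marriage theorem for
  arbitrary families of finite sets, this yields an injection of \<open>n + 1\<close> copies of \<open>G\<close> into \<open>n\<close> copies
  that moves each point by left multiplication with an element of \<open>K\<close> (lemma
  \<open>expanding_imp_compressing\<close>). Such an injection contradicts amenability, since cutting the source copies
  along the translating elements would give \<open>n + 1 \<le> n\<close> (\<open>compressing_not_amenable\<close>). Conversely, if no
  expansion occurs with positive \<open>n\<close>, then normalized counting on Foelner sets gives approximately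
  invariant means, and compactness of \<open>[0, 1]\<^sup>P\<close>, where \<open>P\<close> is the set of all subsets of \<open>G\<close>, gives an
  invariant one (\<open>not_expanding_imp_amenable\<close>).

  On the ring side, an epimorphism \<open>S\<^sup>n \<rightarrow> S\<^sup>n\<^sup>+\<^sup>1\<close> exists iff the identity matrix of size \<open>n + 1\<close> is a product
  of an \<open>(n + 1) \<times> n\<close> by an \<open>n \<times> (n + 1)\<close> matrix (\<open>UGN_iff_not_identity_factors\<close>). Scalar matrices carry
  such a factorization from \<open>R\<close> to the translation ring. If one exists over the translation ring but none
  exists over \<open>R\<close> in any size, then restricting the factors to the rows over a finite \<open>F\<close> factors the
  identity of size \<open>(n + 1) * card F\<close> over \<open>R\<close> through size \<open>n * card (K F)\<close>, where \<open>K\<close> bounds the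
  supports; hence \<open>G\<close> is expanding, so it is not amenable. If \<open>G\<close> is not amenable, then the zero-one matrix of
  the injection above and its transpose factor the identity over the translation ring of every ring. For a
  ring with two elements, which has UGN by counting, this refutes the second assertion.
\<close>

section \<open>Hall's marriage theorem for families of finite sets\<close>

text \<open>
  The index set may be infinite. By Zorn's lemma there is a minimal family of subsets that still
  satisfies Hall's condition; Rado's counting argument shows that its members are singletons.
\<close>

lemma Hall_marriage:
  fixes S :: "'i \<Rightarrow> 'a set"
  assumes fin: "\<And>i. i \<in> I \<Longrightarrow> finite (S i)"
    and hall: "\<And>J. J \<subseteq> I \<Longrightarrow> finite J \<Longrightarrow> card J \<le> card (\<Union>j\<in>J. S j)"
  shows "\<exists>f. inj_on f I \<and> (\<forall>i\<in>I. f i \<in> S i)"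
proof -
  \<comment> \<open>\<open>D\<close> records deleted pairs; maximal deletions correspond to minimal families.\<close>
  define T where "T D j = {a \<in> S j. (j, a) \<notin> D}" for D j
  define \<A> where "\<A> = {D. \<forall>J. J \<subseteq> I \<longrightarrow> finite J \<longrightarrow> card J \<le> card (\<Union>j\<in>J. T D j)}"
  have "{} \<in> \<A>"
    using hall by (simp add: \<A>_def T_def)
  then have "\<A> \<noteq> {}" by blast
  moreover have "\<Union>\<C> \<in> \<A>" if ne: "\<C> \<noteq> {}" and chain: "subset.chain \<A> \<C>" for \<C>
    unfolding \<A>_def
  proof (intro CollectI allI impI)
    fix J assume J: "J \<subseteq> I" "finite J"
    \<comment> \<open>Only finitely many deletions concern a finite \<open>J\<close>, so one member of the chain contains them all.\<close>
    have "finite (Sigma J S \<inter> \<Union>\<C>)"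
      using J fin by (auto intro!: finite_Int finite_SigmaI)
    then obtain D where D: "D \<in> \<C>" "Sigma J S \<inter> \<Union>\<C> \<subseteq> D"
      using finite_subset_Union_chain[OF _ _ ne chain] by (metis Int_lower2)
    have "T (\<Union>\<C>) j = T D j" if "j \<in> J" for j
      using D that by (auto simp: T_def)
    moreover have "D \<in> \<A>"
      using D chain by (auto simp: subset.chain_def)
    ultimately show "card J \<le> card (\<Union>j\<in>J. T (\<Union>\<C>) j)"
      using J by (simp add: \<A>_def)
  qed
  ultimately obtain M where M: "M \<in> \<A>" and max: "\<And>X. X \<in> \<A> \<Longrightarrow> M \<subseteq> X \<Longrightarrow> X = M"
    using subset_Zorn_nonempty[of \<A>] by metis
  have hallM: "card J \<le> card (\<Union>j\<in>J. T M j)" if "J \<subseteq> I" "finite J" for J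
    using M that by (simp add: \<A>_def)
  have finT: "finite (T M i)" if "i \<in> I" for i
    using fin[OF that] by (simp add: T_def)
  \<comment> \<open>By maximality, deleting one more element \<open>x\<close> violates Hall's condition, at a finite set that contains \<open>i\<close>.\<close>
  have blocked: "\<exists>J. J \<subseteq> I \<and> finite J \<and> i \<notin> J
      \<and> card ((T M i - {x}) \<union> (\<Union>j\<in>J. T M j)) \<le> card J"
    if i: "i \<in> I" and x: "x \<in> T M i" for i x
  proof -
    have "insert (i, x) M \<notin> \<A>"
      using max[of "insert (i, x) M"] x by (auto simp: T_def)
    then obtain J where J: "J \<subseteq> I" "finite J"
      and less: "card (\<Union>j\<in>J. T (insert (i, x) M) j) < card J"
      by (auto simp: \<A>_def not_le)
    have off: "T (insert (i, x) M) j = T M j" if "j \<noteq> i" for j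
      using that by (auto simp: T_def)
    have at: "T (insert (i, x) M) i = T M i - {x}"
      by (auto simp: T_def)
    have "i \<in> J"
    proof (rule ccontr)
      assume "i \<notin> J"
      then have "(\<Union>j\<in>J. T (insert (i, x) M) j) = (\<Union>j\<in>J. T M j)"
        by (metis (no_types, lifting) SUP_cong off)
      with hallM[OF J] less show False by simp
    qed
    then have "J = insert i (J - {i})" by blast
    then have "(\<Union>j\<in>J. T (insert (i, x) M) j) =
        T (insert (i, x) M) i \<union> (\<Union>j\<in>J - {i}. T (insert (i, x) M) j)"
      by blast
    also have "\<dots> = (T M i - {x}) \<union> (\<Union>j\<in>J - {i}. T M j)"
      using off at by auto
    finally have "card ((T M i - {x}) \<union> (\<Union>j\<in>J - {i}. T M j)) < card J"
      using less by simp
    moreover have "card (J - {i}) = card J - 1"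
      using \<open>i \<in> J\<close> J by simp
    ultimately show ?thesis
      using J by (intro exI[of _ "J - {i}"]) auto
  qed
  \<comment> \<open>Two distinct elements could both be blocked only against the inclusion-exclusion formula.\<close>
  have unique: "x = y" if i: "i \<in> I" and x: "x \<in> T M i" and y: "y \<in> T M i" for i x y
  proof (rule ccontr)
    assume "x \<noteq> y"
    obtain J where J: "J \<subseteq> I" "finite J" "i \<notin> J"
      and cJ: "card ((T M i - {x}) \<union> (\<Union>j\<in>J. T M j)) \<le> card J"
      using blocked[OF i x] by blast
    obtain L where L: "L \<subseteq> I" "finite L" "i \<notin> L"
      and cL: "card ((T M i - {y}) \<union> (\<Union>j\<in>L. T M j)) \<le> card L"
      using blocked[OF i y] by blast
    let ?X = "(T M i - {x}) \<union> (\<Union>j\<in>J. T M j)"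
    let ?Y = "(T M i - {y}) \<union> (\<Union>j\<in>L. T M j)"
    have finXY: "finite ?X" "finite ?Y"
      using J L i finT by auto
    have "?X \<union> ?Y = (\<Union>j\<in>insert i (J \<union> L). T M j)"
      using \<open>x \<noteq> y\<close> by auto
    then have "card (insert i (J \<union> L)) \<le> card (?X \<union> ?Y)"
      using hallM[of "insert i (J \<union> L)"] i J L by simp
    then have cU: "card (J \<union> L) + 1 \<le> card (?X \<union> ?Y)"
      using J L by simp
    have "card (J \<inter> L) \<le> card (\<Union>j\<in>J \<inter> L. T M j)"
      using hallM[of "J \<inter> L"] J by auto
    also have "\<dots> \<le> card (?X \<inter> ?Y)"
      using finXY by (intro card_mono) auto
    finally have cI: "card (J \<inter> L) \<le> card (?X \<inter> ?Y)" .
    have "card ?X + card ?Y = card (?X \<union> ?Y) + card (?X \<inter> ?Y)"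
      using finXY by (rule card_Un_Int)
    moreover have "card J + card L = card (J \<union> L) + card (J \<inter> L)"
      using J L by (intro card_Un_Int)
    ultimately show False
      using cU cI cJ cL by linarith
  qed
  have "\<exists>a. T M i = {a}" if "i \<in> I" for i
  proof -
    have "T M i \<noteq> {}"
      using hallM[of "{i}"] that by auto
    then show ?thesis
      using unique[OF that] by blast
  qed
  then obtain f where f: "\<And>i. i \<in> I \<Longrightarrow> T M i = {f i}"
    by metis
  have "inj_on f I"
  proof (rule inj_onI, rule ccontr)
    fix i j assume ij: "i \<in> I" "j \<in> I" "f i = f j" "i \<noteq> j"
    have "card {i, j} \<le> card (\<Union>k\<in>{i, j}. T M k)"
      using ij by (intro hallM) auto
    then show False
      using ij f by simp
  qed
  moreover have "\<forall>i\<in>I. f i \<in> S i"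
    using f by (auto simp: T_def)
  ultimately show ?thesis by blast
qed

section \<open>Expansion, injections of bounded displacement, and amenability\<close>

text \<open>
  The negation of the Foelner condition, with the constants made explicit: left multiplication by \<open>K\<close>
  enlarges every finite set by a factor of at least \<open>(n + 1) / n\<close>.
\<close>

definition expanding :: "('g, 'b) monoid_scheme \<Rightarrow> 'g set \<Rightarrow> nat \<Rightarrow> bool" where
  "expanding G K n \<longleftrightarrow> finite K \<and> K \<subseteq> carrier G \<and>
     (\<forall>F. finite F \<longrightarrow> F \<subseteq> carrier G \<longrightarrow> (n + 1) * card F \<le> n * card (K <#>\<^bsub>G\<^esub> F))"

text \<open>
  An injection of \<open>n + 1\<close> copies of the group into \<open>n\<close> copies whose displacement is bounded by \<open>K\<close>. The
  copies are numbered by the second component of a pair.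
\<close>

definition compressing ::
  "('g, 'b) monoid_scheme \<Rightarrow> 'g set \<Rightarrow> nat \<Rightarrow> ('g \<times> nat \<Rightarrow> 'g \<times> nat) \<Rightarrow> bool" where
  "compressing G K n \<phi> \<longleftrightarrow> finite K \<and> K \<subseteq> carrier G \<and>
     inj_on \<phi> (carrier G \<times> {..<n + 1}) \<and>
     (\<forall>x\<in>carrier G. \<forall>i<n + 1. \<phi> (x, i) \<in> (K #>\<^bsub>G\<^esub> x) \<times> {..<n})"

lemma expanding_imp_compressing:
  assumes "expanding G K n"
  shows "\<exists>\<phi>. compressing G K n \<phi>"
proof -
  have K: "finite K" "K \<subseteq> carrier G"
    and exp: "\<And>F. finite F \<Longrightarrow> F \<subseteq> carrier G \<Longrightarrow> (n + 1) * card F \<le> n * card (K <#>\<^bsub>G\<^esub> F)"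
    using assms by (auto simp: expanding_def)
  let ?I = "carrier G \<times> {..<n + 1}"
  let ?S = "\<lambda>p. (K #>\<^bsub>G\<^esub> fst p) \<times> {..<n}"
  have "\<exists>\<phi>. inj_on \<phi> ?I \<and> (\<forall>p\<in>?I. \<phi> p \<in> ?S p)"
  proof (rule Hall_marriage)
    show "finite (?S p)" for p
      using K by (simp add: r_coset_def)
  next
    fix J assume J: "J \<subseteq> ?I" "finite J"
    let ?F = "fst ` J"
    have "J \<subseteq> ?F \<times> {..<n + 1}"
      using J by force
    then have "card J \<le> card (?F \<times> {..<n + 1})"
      using J by (intro card_mono) auto
    also have "\<dots> = (n + 1) * card ?F"
      by (simp add: card_cartesian_product)
    also have "\<dots> \<le> n * card (K <#>\<^bsub>G\<^esub> ?F)"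
      using J by (intro exp) auto
    also have "\<dots> = card ((K <#>\<^bsub>G\<^esub> ?F) \<times> {..<n})"
      by (simp add: card_cartesian_product)
    also have "(K <#>\<^bsub>G\<^esub> ?F) \<times> {..<n} = (\<Union>p\<in>J. ?S p)"
      by (auto simp: set_mult_def r_coset_def)
    finally show "card J \<le> card (\<Union>p\<in>J. ?S p)" .
  qed
  then show ?thesis
    using K unfolding compressing_def by fastforce
qed

text \<open>
  The value of \<open>\<mu>\<close> at \<open>\<Omega>\<close> is needed to be finite in order to conclude that \<open>\<mu> {} = 0\<close>.
\<close>

lemma additive_on_finite_partition:
  fixes \<mu> :: "'a set \<Rightarrow> ennreal"
  assumes add: "\<And>A B. A \<subseteq> \<Omega> \<Longrightarrow> B \<subseteq> \<Omega> \<Longrightarrow> A \<inter> B = {} \<Longrightarrow> \<mu> (A \<union> B) = \<mu> A + \<mu> B"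
    and one: "\<mu> \<Omega> = 1"
    and "finite J" "\<And>j. j \<in> J \<Longrightarrow> D j \<subseteq> \<Omega>"
    and "\<And>i j. i \<in> J \<Longrightarrow> j \<in> J \<Longrightarrow> i \<noteq> j \<Longrightarrow> D i \<inter> D j = {}"
  shows "\<mu> (\<Union>j\<in>J. D j) = (\<Sum>j\<in>J. \<mu> (D j))"
  using assms(3-5)
proof (induction J rule: finite_induct)
  case empty
  have "\<mu> {} + 1 = 0 + 1"
    using add[of "{}" \<Omega>] one by simp
  then have "\<mu> {} = 0"
    by (metis add.commute ennreal_add_left_cancel infinity_ennreal_def ennreal_one_neq_top)
  then show ?case by simp
next
  case (insert k J)
  have "\<mu> (D k \<union> (\<Union>j\<in>J. D j)) = \<mu> (D k) + \<mu> (\<Union>j\<in>J. D j)"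
    using insert.prems insert.hyps by (intro add) (auto, blast)
  with insert show ?case by simp
qed

lemma compressing_not_amenable:
  fixes G (structure)
  assumes "group G" and \<phi>: "compressing G K n \<phi>"
  shows "\<not> amenable G"
proof
  interpret group G by fact
  assume "amenable G"
  then obtain \<mu> :: "'a set \<Rightarrow> ennreal" where
    "\<forall>A B. A \<subseteq> carrier G \<longrightarrow> B \<subseteq> carrier G \<longrightarrow> A \<inter> B = {} \<longrightarrow> \<mu> (A \<union> B) = \<mu> A + \<mu> B"
    "\<forall>A. A \<subseteq> carrier G \<longrightarrow> (\<forall>g\<in>carrier G. \<mu> (g <# A) = \<mu> A)"
    and one: "\<mu> (carrier G) = 1"
    unfolding amenable_def by (elim exE conjE) (rule that)
  then have add: "\<And>A B. A \<subseteq> carrier G \<Longrightarrow> B \<subseteq> carrier G \<Longrightarrow> A \<inter> B = {} \<Longrightarrow> \<mu> (A \<union> B) = \<mu> A + \<mu> B"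
    and inv: "\<And>A g. A \<subseteq> carrier G \<Longrightarrow> g \<in> carrier G \<Longrightarrow> \<mu> (g <# A) = \<mu> A"
    by simp_all
  have K: "finite K" "K \<subseteq> carrier G" and inj: "inj_on \<phi> (carrier G \<times> {..<n + 1})"
    and in_K: "\<And>x i. x \<in> carrier G \<Longrightarrow> i < n + 1 \<Longrightarrow> \<phi> (x, i) \<in> (K #> x) \<times> {..<n}"
    using \<phi> by (auto simp: compressing_def)
  note partition = additive_on_finite_partition[OF add one]
  \<comment> \<open>The part of copy \<open>i\<close> that is translated by \<open>k\<close> into copy \<open>j\<close>.\<close>
  define D where "D i k j = {x \<in> carrier G. \<phi> (x, i) = (k \<otimes> x, j)}" for i k j
  have D_sub: "D i k j \<subseteq> carrier G" for i k j
    by (auto simp: D_def)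
  have source: "(\<Sum>(k, j)\<in>K \<times> {..<n}. \<mu> (D i k j)) = 1" if i: "i < n + 1" for i
  proof -
    have "(\<Union>(k, j)\<in>K \<times> {..<n}. D i k j) = carrier G"
      using in_K i by (fastforce simp: D_def r_coset_def)
    moreover have "\<mu> (\<Union>p\<in>K \<times> {..<n}. D i (fst p) (snd p))
        = (\<Sum>p\<in>K \<times> {..<n}. \<mu> (D i (fst p) (snd p)))"
    proof (rule partition)
      show "D i (fst p) (snd p) \<inter> D i (fst q) (snd q) = {}"
        if p: "p \<in> K \<times> {..<n}" and q: "q \<in> K \<times> {..<n}" and "p \<noteq> q" for p q
      proof (rule ccontr)
        assume "D i (fst p) (snd p) \<inter> D i (fst q) (snd q) \<noteq> {}"
        then obtain x where "x \<in> D i (fst p) (snd p)" "x \<in> D i (fst q) (snd q)"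
          by blast
        then have "x \<in> carrier G" "fst p \<otimes> x = fst q \<otimes> x" "snd p = snd q"
          by (simp_all add: D_def)
        moreover have "fst p \<in> carrier G" "fst q \<in> carrier G"
          using p q K by auto
        ultimately show False
          using \<open>p \<noteq> q\<close> by (simp add: prod_eq_iff)
      qed
    qed (use K D_sub in auto)
    ultimately show ?thesis
      using one by (simp add: case_prod_beta)
  qed
  have target: "(\<Sum>(i, k)\<in>{..<n + 1} \<times> K. \<mu> (D i k j)) \<le> 1" for j
  proof -
    let ?E = "\<lambda>p. snd p <# D (fst p) (snd p) j"
    have E_sub: "?E p \<subseteq> carrier G" if "p \<in> {..<n + 1} \<times> K" for p
      using that K by (auto simp: D_def l_coset_def)
    have disj: "?E p \<inter> ?E q = {}"
      if p: "p \<in> {..<n + 1} \<times> K" and q: "q \<in> {..<n + 1} \<times> K" and "p \<noteq> q" for p q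
    proof (rule ccontr)
      assume "?E p \<inter> ?E q \<noteq> {}"
      then obtain x y where x: "x \<in> D (fst p) (snd p) j" and y: "y \<in> D (fst q) (snd q) j"
        and eq: "snd p \<otimes> x = snd q \<otimes> y"
        by (auto simp: l_coset_def)
      have xy: "x \<in> carrier G" "y \<in> carrier G"
        using x y D_sub by blast+
      have pq: "fst p < n + 1" "fst q < n + 1" "snd p \<in> carrier G" "snd q \<in> carrier G"
        using p q K by auto
      have "\<phi> (x, fst p) = (snd p \<otimes> x, j)" "\<phi> (y, fst q) = (snd q \<otimes> y, j)"
        using x y by (simp_all only: D_def mem_Collect_eq)
      then have "\<phi> (x, fst p) = \<phi> (y, fst q)"
        by (simp only: eq)
      then have same: "(x, fst p) = (y, fst q)"
        by (rule inj_onD[OF inj]) (use xy pq in simp_all)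
      then have "snd p \<otimes> x = snd q \<otimes> x"
        using eq by simp
      then have "snd p = snd q"
        using xy pq by simp
      then show False
        using \<open>p \<noteq> q\<close> same by (simp add: prod_eq_iff)
    qed
    have "(\<Sum>(i, k)\<in>{..<n + 1} \<times> K. \<mu> (D i k j)) = (\<Sum>p\<in>{..<n + 1} \<times> K. \<mu> (?E p))"
    proof (intro sum.cong refl)
      fix p assume "p \<in> {..<n + 1} \<times> K"
      then have "snd p \<in> carrier G"
        using K by auto
      then show "(case p of (i, k) \<Rightarrow> \<mu> (D i k j)) = \<mu> (?E p)"
        by (simp add: inv[OF D_sub] case_prod_beta)
    qed
    also have "\<dots> = \<mu> (\<Union>p\<in>{..<n + 1} \<times> K. ?E p)"
      by (rule partition[symmetric]) (use K E_sub disj in simp_all)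
    also have "\<dots> \<le> \<mu> (\<Union>p\<in>{..<n + 1} \<times> K. ?E p)
        + \<mu> (carrier G - (\<Union>p\<in>{..<n + 1} \<times> K. ?E p))"
      by simp
    also have "\<dots> = \<mu> ((\<Union>p\<in>{..<n + 1} \<times> K. ?E p)
        \<union> (carrier G - (\<Union>p\<in>{..<n + 1} \<times> K. ?E p)))"
      using E_sub by (intro add[symmetric]) auto
    also have "\<dots> = 1"
    proof -
      have "(\<Union>p\<in>{..<n + 1} \<times> K. ?E p) \<subseteq> carrier G"
        by (rule UN_least) (rule E_sub)
      then show ?thesis
        by (simp only: Un_Diff_cancel Un_absorb1 one)
    qed
    finally show ?thesis .
  qed
  have "of_nat (n + 1) = (\<Sum>i<n + 1. \<Sum>(k, j)\<in>K \<times> {..<n}. \<mu> (D i k j))"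
    using source by simp
  also have "\<dots> = (\<Sum>i<n + 1. \<Sum>k\<in>K. \<Sum>j<n. \<mu> (D i k j))"
    by (simp add: sum.cartesian_product)
  also have "\<dots> = (\<Sum>i<n + 1. \<Sum>j<n. \<Sum>k\<in>K. \<mu> (D i k j))"
    by (intro sum.cong refl sum.swap)
  also have "\<dots> = (\<Sum>j<n. \<Sum>i<n + 1. \<Sum>k\<in>K. \<mu> (D i k j))"
    by (rule sum.swap)
  also have "\<dots> = (\<Sum>j<n. \<Sum>(i, k)\<in>{..<n + 1} \<times> K. \<mu> (D i k j))"
    by (simp only: sum.cartesian_product)
  also have "\<dots> \<le> (\<Sum>j<n. 1)"
    by (intro sum_mono target)
  also have "\<dots> = of_nat n"
    by simp
  finally have "(of_nat (n + 1) :: ennreal) \<le> of_nat n" .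
  then show False
    by (simp only: of_nat_le_iff)
qed

text \<open>
  Tychonoff's theorem in the product topology on functions.
\<close>

lemma compact_unit_cube: "compact {m :: 'a \<Rightarrow> real. \<forall>x. m x \<in> {0..1}}"
proof -
  have "compactin (product_topology (\<lambda>_. euclidean) UNIV) (PiE UNIV (\<lambda>_::'a. {0..1::real}))"
    by (subst compactin_PiE) auto
  then show ?thesis
    by (simp add: euclidean_product_topology PiE_UNIV_domain Pi_def)
qed

text \<open>
  Counting on \<open>F\<close> is invariant under translation by \<open>g\<close> up to the number of points by which \<open>g F\<close>
  leaves \<open>F\<close>.
\<close>

lemma card_translate_Int_diff:
  fixes G (structure)
  assumes "group G" and g: "g \<in> carrier G" and F: "finite F" "F \<subseteq> carrier G" and A: "A \<subseteq> carrier G"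
  shows "\<bar>real (card ((g <#\<^bsub>G\<^esub> A) \<inter> F)) - real (card (A \<inter> F))\<bar> \<le> real (card ((g <#\<^bsub>G\<^esub> F) - F))"
proof -
  interpret group G by fact
  have im: "g <# X = (\<lambda>x. g \<otimes> x) ` X" for X
    by (auto simp: l_coset_def)
  have inj: "inj_on (\<lambda>x. g \<otimes> x) (carrier G)"
    using g by (auto intro: inj_onI)
  have cardim: "card (g <# X) = card X" if "X \<subseteq> carrier G" for X
    unfolding im using card_image inj_on_subset[OF inj that] by blast
  have Int: "g <# (A \<inter> F) = (g <# A) \<inter> (g <# F)"
    unfolding im using inj_on_image_Int[OF inj A F(2)] .
  have fin: "finite (g <# F)"
    using F by (simp add: im)
  have eq: "card (F - (g <# F)) = card ((g <# F) - F)"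
    using cardim[OF F(2)] F fin
    by (metis Int_commute card_Diff_subset_Int finite_Int)
  have "card (A \<inter> F) = card ((g <# A) \<inter> (g <# F))"
    unfolding Int[symmetric] using A by (intro cardim[symmetric]) auto
  moreover have "card ((g <# A) \<inter> (g <# F)) \<le> card (((g <# A) \<inter> F) \<union> ((g <# F) - F))"
    using F fin by (intro card_mono) auto
  moreover have "card (((g <# A) \<inter> F) \<union> ((g <# F) - F)) \<le> card ((g <# A) \<inter> F) + card ((g <# F) - F)"
    by (rule card_Un_le)
  moreover have "card ((g <# A) \<inter> F) \<le> card (((g <# A) \<inter> (g <# F)) \<union> (F - (g <# F)))"
    using F fin by (intro card_mono) auto
  moreover have "card (((g <# A) \<inter> (g <# F)) \<union> (F - (g <# F)))
      \<le> card ((g <# A) \<inter> (g <# F)) + card (F - (g <# F))"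
    by (rule card_Un_le)
  ultimately show ?thesis
    using eq by linarith
qed

lemma not_expanding_imp_amenable:
  fixes G (structure)
  assumes "group G" and nonexp: "\<And>K n. n > 0 \<Longrightarrow> \<not> expanding G K n"
  shows "amenable G"
proof -
  interpret group G by fact
  \<comment> \<open>\<open>U\<close> consists of the finitely additive probabilities, and \<open>V (g, n)\<close> of the functions that are
    invariant under \<open>g\<close> up to \<open>1 / (n + 1)\<close>.\<close>
  define U :: "('a set \<Rightarrow> real) set" where
    "U = {m. \<forall>A. m A \<in> {0..1}} \<inter> {m. m (carrier G) = 1} \<inter>
      {m. \<forall>A B. A \<inter> B = {} \<longrightarrow> m (A \<union> B) = m A + m B}"
  define V :: "'a \<times> nat \<Rightarrow> ('a set \<Rightarrow> real) set" where
    "V = (\<lambda>(g, n). {m. \<forall>A. A \<subseteq> carrier G \<longrightarrow> \<bar>m (g <# A) - m A\<bar> \<le> 1 / real (Suc n)})"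
  have cont: "continuous_on UNIV (\<lambda>m :: 'a set \<Rightarrow> real. m A)" for A
    by simp
  have "compact U"
    unfolding U_def
    by (intro compact_Int_closed compact_unit_cube closed_Collect_all closed_Collect_imp
        closed_Collect_eq open_Collect_const continuous_intros cont)
  moreover have "closed (V p)" for p
    unfolding V_def
    by (cases p) (auto intro!: closed_Collect_all closed_Collect_imp closed_Collect_le
        open_Collect_const continuous_intros cont)
  moreover have "U \<inter> (\<Inter>p\<in>I. V p) \<noteq> {}" if I: "finite I" "I \<subseteq> carrier G \<times> UNIV" for I
  proof -
    \<comment> \<open>Finitely many conditions are met by normalized counting on a suitable Foelner set. The unit is
      put into \<open>K\<close> so that \<open>F \<subseteq> K F\<close>.\<close>
    define K where "K = insert \<one> (fst ` I)"
    define N where "N = Suc (Max (insert 0 (snd ` I)))"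
    have K: "finite K" "K \<subseteq> carrier G" "\<one> \<in> K"
      using I by (auto simp: K_def)
    have "\<not> expanding G K N"
      using nonexp by (simp add: N_def)
    then obtain F where F: "finite F" "F \<subseteq> carrier G" and less: "N * card (K <#> F) < (N + 1) * card F"
      using K by (auto simp: expanding_def not_le)
    have pos: "card F > 0"
      using less by (cases "card F") auto
    define m where "m A = real (card (A \<inter> F)) / real (card F)" for A
    have "m \<in> U"
    proof -
      have "card (A \<inter> F) \<le> card F" for A
        using F by (intro card_mono) auto
      moreover have "card ((A \<union> B) \<inter> F) = card (A \<inter> F) + card (B \<inter> F)" if "A \<inter> B = {}" for A B
        using F that by (subst card_Un_disjoint[symmetric]) (auto simp: Int_Un_distrib2)
      moreover have "carrier G \<inter> F = F"
        using F by blast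
      ultimately show ?thesis
        using pos by (auto simp: U_def m_def add_divide_distrib)
    qed
    moreover have "m \<in> V (g, n)" if gn: "(g, n) \<in> I" for g n
    proof -
      have g: "g \<in> carrier G" "g \<in> K"
        using gn I by (auto simp: K_def image_iff intro!: bexI[of _ "(g, n)"])
      have "n \<le> Max (insert 0 (snd ` I))"
        using gn I by (intro Max_ge) (auto simp: image_iff intro!: bexI[of _ "(g, n)"])
      then have n: "Suc n \<le> N"
        by (simp add: N_def)
      have KF: "finite (K <#> F)"
        using K F by (auto simp: set_mult_def)
      have "F \<subseteq> K <#> F"
        using K F by (force simp: set_mult_def)
      have "card ((g <# F) - F) \<le> card ((K <#> F) - F)"
        using KF g by (intro card_mono) (auto simp: set_mult_def l_coset_def)
      also have "\<dots> = card (K <#> F) - card F"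
        using F \<open>F \<subseteq> K <#> F\<close> by (intro card_Diff_subset) auto
      finally have "N * card ((g <# F) - F) \<le> N * (card (K <#> F) - card F)"
        by (rule mult_le_mono2)
      also have "\<dots> = N * card (K <#> F) - N * card F"
        by (rule diff_mult_distrib2)
      also have "\<dots> \<le> card F"
        using less by simp
      finally have "N * card ((g <# F) - F) \<le> card F" .
      moreover have "Suc n * card ((g <# F) - F) \<le> N * card ((g <# F) - F)"
        using n by (rule mult_le_mono1)
      ultimately have "Suc n * card ((g <# F) - F) \<le> card F"
        by linarith
      then have bound: "real (Suc n) * real (card ((g <# F) - F)) \<le> real (card F)"
        by (metis of_nat_le_iff of_nat_mult)
      have "\<bar>m (g <# A) - m A\<bar> \<le> 1 / real (Suc n)" if "A \<subseteq> carrier G" for A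
      proof -
        have "\<bar>m (g <# A) - m A\<bar>
            = \<bar>real (card ((g <# A) \<inter> F)) - real (card (A \<inter> F))\<bar> / real (card F)"
          by (simp add: m_def flip: diff_divide_distrib)
        also have "\<dots> \<le> real (card ((g <# F) - F)) / real (card F)"
          using card_translate_Int_diff[OF \<open>group G\<close> g(1) F that] by (intro divide_right_mono) auto
        also have "\<dots> \<le> 1 / real (Suc n)"
          using bound pos by (simp add: field_simps)
        finally show ?thesis .
      qed
      then show ?thesis
        by (simp add: V_def)
    qed
    ultimately have "m \<in> U \<inter> (\<Inter>p\<in>I. V p)"
      by auto
    then show ?thesis
      by blast
  qed
  ultimately have "U \<inter> (\<Inter>p\<in>carrier G \<times> UNIV. V p) \<noteq> {}"
    by (rule compact_imp_fip_image) auto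
  then obtain m where mU: "m \<in> U" and mV: "\<And>p. p \<in> carrier G \<times> UNIV \<Longrightarrow> m \<in> V p"
    by blast
  have inv: "m (g <# A) = m A" if "g \<in> carrier G" "A \<subseteq> carrier G" for g A
  proof -
    have "\<bar>m (g <# A) - m A\<bar> \<le> 1 / real (Suc n)" for n
      using mV[of "(g, n)"] that by (simp add: V_def)
    then have "\<not> \<bar>m (g <# A) - m A\<bar> > 0"
      using nat_approx_posE by (metis not_le)
    then show ?thesis by simp
  qed
  have nonneg: "m A \<ge> 0" for A
    using mU by (auto simp: U_def)
  show ?thesis
    unfolding amenable_def
  proof (intro exI[of _ "\<lambda>A. ennreal (m A)"] conjI allI impI ballI)
    show "ennreal (m (A \<union> B)) = ennreal (m A) + ennreal (m B)" if "A \<inter> B = {}" for A B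
      using mU that nonneg by (simp add: U_def flip: ennreal_plus)
    show "ennreal (m (g <# A)) = ennreal (m A)" if "A \<subseteq> carrier G" "g \<in> carrier G" for A g
      using inv that by simp
    show "ennreal (m (carrier G)) = 1"
      using mU by (simp add: U_def)
  qed
qed

section \<open>Unbounded generating number in terms of matrices\<close>

text \<open>
  The identity matrix indexed by \<open>P\<close> is a product of a \<open>P \<times> Q\<close> matrix and a \<open>Q \<times> P\<close> matrix over
  \<open>S\<close>. Matrices are curried functions, constrained only on the index sets; \<open>Q\<close> is meant to be finite,
  since \<open>finsum\<close> over an infinite set is zero.
\<close>

definition identity_factors ::
  "('s, 'b) ring_scheme \<Rightarrow> 'p set \<Rightarrow> 'q set \<Rightarrow> bool" where
  "identity_factors S P Q \<longleftrightarrow> (\<exists>A B.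
     (\<forall>p\<in>P. \<forall>q\<in>Q. A p q \<in> carrier S \<and> B q p \<in> carrier S) \<and>
     (\<forall>p\<in>P. \<forall>p'\<in>P. (\<Oplus>\<^bsub>S\<^esub>q\<in>Q. A p q \<otimes>\<^bsub>S\<^esub> B q p') = (if p = p' then \<one>\<^bsub>S\<^esub> else \<zero>\<^bsub>S\<^esub>)))"

lemma (in abelian_monoid) finsum_swap:
  assumes "finite A" "finite B" "\<And>a b. a \<in> A \<Longrightarrow> b \<in> B \<Longrightarrow> f a b \<in> carrier G"
  shows "(\<Oplus>a\<in>A. \<Oplus>b\<in>B. f a b) = (\<Oplus>b\<in>B. \<Oplus>a\<in>A. f a b)"
  using assms(1,3)
proof (induction A rule: finite_induct)
  case empty
  then show ?case by (simp add: finsum_zero)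
next
  case (insert x A)
  have "(\<Oplus>a\<in>insert x A. \<Oplus>b\<in>B. f a b) = (\<Oplus>b\<in>B. f x b) \<oplus> (\<Oplus>a\<in>A. \<Oplus>b\<in>B. f a b)"
    using insert by (intro finsum_insert) (auto intro!: finsum_closed)
  also have "\<dots> = (\<Oplus>b\<in>B. f x b) \<oplus> (\<Oplus>b\<in>B. \<Oplus>a\<in>A. f a b)"
    using insert by simp
  also have "\<dots> = (\<Oplus>b\<in>B. f x b \<oplus> (\<Oplus>a\<in>A. f a b))"
    using insert by (intro finsum_addf[symmetric]) (auto intro!: finsum_closed)
  also have "\<dots> = (\<Oplus>b\<in>B. \<Oplus>a\<in>insert x A. f a b)"
    using insert by (intro finsum_cong' refl finsum_insert[symmetric]) (auto intro!: finsum_closed)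
  finally show ?case .
qed

lemma (in abelian_monoid) finsum_Times:
  assumes "finite A" "finite B" "\<And>a b. a \<in> A \<Longrightarrow> b \<in> B \<Longrightarrow> f (a, b) \<in> carrier G"
  shows "(\<Oplus>p\<in>A \<times> B. f p) = (\<Oplus>a\<in>A. \<Oplus>b\<in>B. f (a, b))"
  using assms(1,3)
proof (induction A rule: finite_induct)
  case empty
  then show ?case by simp
next
  case (insert x A)
  have "(\<Oplus>p\<in>insert x A \<times> B. f p) = (\<Oplus>p\<in>Pair x ` B \<union> A \<times> B. f p)"
    by (intro arg_cong[where f = "finsum G f"]) auto
  also have "\<dots> = (\<Oplus>p\<in>Pair x ` B. f p) \<oplus> (\<Oplus>p\<in>A \<times> B. f p)"
    using insert assms(2) by (intro finsum_Un_disjoint) auto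
  also have "(\<Oplus>p\<in>Pair x ` B. f p) = (\<Oplus>b\<in>B. f (x, b))"
    using insert by (intro finsum_reindex) (auto intro: inj_onI)
  also have "(\<Oplus>b\<in>B. f (x, b)) \<oplus> (\<Oplus>p\<in>A \<times> B. f p) = (\<Oplus>a\<in>insert x A. \<Oplus>b\<in>B. f (a, b))"
    using insert by (subst finsum_insert) (auto intro!: finsum_closed)
  finally show ?case .
qed

lemma (in abelian_monoid) finsum_superset:
  assumes "finite B" "A \<subseteq> B" "\<And>x. x \<in> A \<Longrightarrow> f x \<in> carrier G" "\<And>x. x \<in> B - A \<Longrightarrow> f x = \<zero>"
  shows "(\<Oplus>x\<in>A. f x) = (\<Oplus>x\<in>B. f x)"
  using assms by (intro add.finprod_mono_neutral_cong_left) (auto, metis DiffI zero_closed)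

lemma (in abelian_monoid) finsum_single:
  assumes "finite A" "a \<in> A" "f a \<in> carrier G" "\<And>x. x \<in> A \<Longrightarrow> x \<noteq> a \<Longrightarrow> f x = \<zero>"
  shows "(\<Oplus>x\<in>A. f x) = f a"
proof -
  have "(\<Oplus>x\<in>{a}. f x) = (\<Oplus>x\<in>A. f x)"
    using assms by (intro finsum_superset) auto
  then show ?thesis
    using assms by simp
qed

text \<open>
  The rows are restricted along an injection of \<open>P'\<close> into \<open>P\<close>, and the inner index set is enlarged along an
  injection of \<open>Q\<close> into \<open>Q'\<close>, with zero entries outside its image. Thus only the cardinalities matter.
\<close>

lemma identity_factors_mono:
  assumes "ring S" and fact: "identity_factors S P Q"
    and fin: "finite P" "finite Q" "finite P'" "finite Q'"
    and card: "card P' \<le> card P" "card Q \<le> card Q'"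
  shows "identity_factors S P' Q'"
proof -
  interpret ring S by fact
  obtain A B where AB: "\<And>p q. p \<in> P \<Longrightarrow> q \<in> Q \<Longrightarrow> A p q \<in> carrier S \<and> B q p \<in> carrier S"
    and one: "\<And>p p'. p \<in> P \<Longrightarrow> p' \<in> P \<Longrightarrow>
      (\<Oplus>\<^bsub>S\<^esub>q\<in>Q. A p q \<otimes>\<^bsub>S\<^esub> B q p') = (if p = p' then \<one>\<^bsub>S\<^esub> else \<zero>\<^bsub>S\<^esub>)"
    using fact unfolding identity_factors_def by blast
  obtain g where g: "g ` P' \<subseteq> P" "inj_on g P'"
    using card_le_inj[OF fin(3,1) card(1)] by blast
  obtain h where h: "h ` Q \<subseteq> Q'" "inj_on h Q"
    using card_le_inj[OF fin(2,4) card(2)] by blast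
  define A' where "A' p q = (if q \<in> h ` Q then A (g p) (inv_into Q h q) else \<zero>\<^bsub>S\<^esub>)" for p q
  define B' where "B' q p = (if q \<in> h ` Q then B (inv_into Q h q) (g p) else \<zero>\<^bsub>S\<^esub>)" for q p
  have closed: "A' p q \<in> carrier S" "B' q p \<in> carrier S" if "p \<in> P'" for p q
    using that AB g h by (auto simp: A'_def B'_def inv_into_into image_subset_iff)
  have "(\<Oplus>\<^bsub>S\<^esub>q\<in>Q'. A' p q \<otimes>\<^bsub>S\<^esub> B' q p') = (if p = p' then \<one>\<^bsub>S\<^esub> else \<zero>\<^bsub>S\<^esub>)"
    if p: "p \<in> P'" "p' \<in> P'" for p p'
  proof -
    have gp: "g p \<in> P" "g p' \<in> P"
      using p g by auto
    have prod: "A' p q \<otimes>\<^bsub>S\<^esub> B' q p' \<in> carrier S" for q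
      using closed p by blast
    have "(\<Oplus>\<^bsub>S\<^esub>q\<in>Q'. A' p q \<otimes>\<^bsub>S\<^esub> B' q p') = (\<Oplus>\<^bsub>S\<^esub>q\<in>h ` Q. A' p q \<otimes>\<^bsub>S\<^esub> B' q p')"
    proof (rule finsum_superset[symmetric, OF fin(4) h(1) prod])
      fix q assume "q \<in> Q' - h ` Q"
      then have "A' p q = \<zero>\<^bsub>S\<^esub>" "B' q p' = \<zero>\<^bsub>S\<^esub>"
        by (simp_all only: A'_def B'_def if_False Diff_iff)
      then show "A' p q \<otimes>\<^bsub>S\<^esub> B' q p' = \<zero>\<^bsub>S\<^esub>"
        by simp
    qed
    also have "\<dots> = (\<Oplus>\<^bsub>S\<^esub>q\<in>Q. A' p (h q) \<otimes>\<^bsub>S\<^esub> B' (h q) p')"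
      using prod h by (intro finsum_reindex) (simp_all add: Pi_I)
    also have "\<dots> = (\<Oplus>\<^bsub>S\<^esub>q\<in>Q. A (g p) q \<otimes>\<^bsub>S\<^esub> B q (g p'))"
    proof (intro finsum_cong' refl Pi_I)
      fix q assume q: "q \<in> Q"
      show "A (g p) q \<otimes>\<^bsub>S\<^esub> B q (g p') \<in> carrier S"
        using AB gp q by simp
      show "A' p (h q) \<otimes>\<^bsub>S\<^esub> B' (h q) p' = A (g p) q \<otimes>\<^bsub>S\<^esub> B q (g p')"
        using q h(2) by (simp add: A'_def B'_def)
    qed
    also have "\<dots> = (if p = p' then \<one>\<^bsub>S\<^esub> else \<zero>\<^bsub>S\<^esub>)"
      using one[OF gp] inj_on_eq_iff[OF g(2) p] by simp
    finally show ?thesis .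
  qed
  then show ?thesis
    unfolding identity_factors_def using closed by blast
qed

text \<open>
  The vector of length \<open>n\<close> with entry one in position \<open>j\<close> (the zero vector if \<open>j \<ge> n\<close>).
\<close>

definition unit_vector :: "('s, 'b) ring_scheme \<Rightarrow> nat \<Rightarrow> nat \<Rightarrow> (nat \<Rightarrow> 's)" where
  "unit_vector S n j = (\<lambda>i\<in>{..<n}. if i = j then \<one>\<^bsub>S\<^esub> else \<zero>\<^bsub>S\<^esub>)"

lemma free_carrier_eqI:
  assumes "v \<in> free_carrier S n" "w \<in> free_carrier S n" "\<And>i. i < n \<Longrightarrow> v i = w i"
  shows "v = w"
  using assms unfolding free_carrier_def by (intro PiE_ext) auto

lemma free_carrierD: "v \<in> free_carrier S n \<Longrightarrow> i < n \<Longrightarrow> v i \<in> carrier S"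
  by (auto simp: free_carrier_def)

lemma free_right_hom_add:
  "f \<in> free_right_hom S m n \<Longrightarrow> v \<in> free_carrier S m \<Longrightarrow> w \<in> free_carrier S m
    \<Longrightarrow> f (free_add S m v w) = free_add S n (f v) (f w)"
  by (simp add: free_right_hom_def)

lemma free_right_hom_rscale:
  "f \<in> free_right_hom S m n \<Longrightarrow> v \<in> free_carrier S m \<Longrightarrow> s \<in> carrier S
    \<Longrightarrow> f (free_rscale S m v s) = free_rscale S n (f v) s"
  by (simp add: free_right_hom_def)

lemma free_right_hom_closed:
  "f \<in> free_right_hom S m n \<Longrightarrow> v \<in> free_carrier S m \<Longrightarrow> f v \<in> free_carrier S n"
  by (auto simp: free_right_hom_def)

text \<open>
  A homomorphism of free modules is given by the matrix of its values at the unit vectors. The bound \<open>k\<close>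
  on the support of \<open>v\<close> is there for the induction.
\<close>

lemma (in ring) free_right_hom_entry:
  assumes f: "f \<in> free_right_hom R m n" and i: "i < n" and "k \<le> m"
    and "v \<in> free_carrier R m" "\<And>j. k \<le> j \<Longrightarrow> j < m \<Longrightarrow> v j = \<zero>"
  shows "f v i = (\<Oplus>j\<in>{..<k}. f (unit_vector R m j) i \<otimes> v j)"
  using assms(3-)
proof (induction k arbitrary: v)
  have closed: "w \<in> free_carrier R m \<Longrightarrow> f w i \<in> carrier R" for w
    using free_carrierD[OF free_right_hom_closed[OF f] i] .
  case 0
  have "v = free_rscale R m v \<zero>"
    using 0 free_carrierD[OF 0(2)]
    by (intro free_carrier_eqI[of v R m]) (auto simp: free_rscale_def free_carrier_def)
  then have "f v = f (free_rscale R m v \<zero>)"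
    by (rule arg_cong)
  also have "\<dots> = free_rscale R n (f v) \<zero>"
    by (rule free_right_hom_rscale[OF f 0(2) zero_closed])
  finally have "f v i = f v i \<otimes> \<zero>"
    using i by (metis free_rscale_def lessThan_iff restrict_apply')
  then show ?case
    using closed 0 by simp
next
  case (Suc k)
  have closed: "w \<in> free_carrier R m \<Longrightarrow> f w i \<in> carrier R" for w
    using free_carrierD[OF free_right_hom_closed[OF f] i] .
  have e: "unit_vector R m j \<in> free_carrier R m" for j
    by (auto simp: unit_vector_def free_carrier_def)
  have v: "v j \<in> carrier R" if "j < m" for j
    using Suc.prems that by (auto simp: free_carrier_def PiE_iff)
  have km: "k < m"
    using Suc.prems by simp
  let ?w = "v(k := \<zero>)" and ?u = "free_rscale R m (unit_vector R m k) (v k)"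
  have w: "?w \<in> free_carrier R m"
    using Suc.prems km by (auto simp: free_carrier_def PiE_iff extensional_def)
  have u: "?u \<in> free_carrier R m"
    using e[of k] v[OF km] by (auto simp: free_carrier_def free_rscale_def PiE_iff)
  have "free_add R m ?w ?u \<in> free_carrier R m"
    using free_carrierD[OF w] free_carrierD[OF u] by (auto simp: free_add_def free_carrier_def)
  then have "v = free_add R m ?w ?u"
    using Suc.prems(2) v km
    by (intro free_carrier_eqI[of v R m])
      (auto simp: free_add_def free_rscale_def unit_vector_def)
  then have "f v = f (free_add R m ?w ?u)"
    by (rule arg_cong)
  also have "\<dots> = free_add R n (f ?w) (f ?u)"
    by (rule free_right_hom_add[OF f w u])
  finally have "f v = free_add R n (f ?w) (f ?u)" .
  moreover have "f ?u = free_rscale R n (f (unit_vector R m k)) (v k)"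
    using free_right_hom_rscale[OF f e v[OF km]] .
  ultimately have "f v i = f ?w i \<oplus> f (unit_vector R m k) i \<otimes> v k"
    using i by (simp add: free_add_def free_rscale_def)
  also have "f ?w i = (\<Oplus>j\<in>{..<k}. f (unit_vector R m j) i \<otimes> ?w j)"
  proof (rule Suc.IH[OF _ w])
    show "k \<le> m"
      using km by simp
    show "?w j = \<zero>" if "k \<le> j" "j < m" for j
      using Suc.prems(3)[of j] that by (cases "j = k") auto
  qed
  also have "\<dots> = (\<Oplus>j\<in>{..<k}. f (unit_vector R m j) i \<otimes> v j)"
    using closed[OF e] v km by (intro finsum_cong' refl) auto
  also have "\<dots> \<oplus> f (unit_vector R m k) i \<otimes> v k
      = f (unit_vector R m k) i \<otimes> v k \<oplus> (\<Oplus>j\<in>{..<k}. f (unit_vector R m j) i \<otimes> v j)"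
    using closed[OF e] v km by (intro a_comm finsum_closed) auto
  also have "\<dots> = (\<Oplus>j\<in>{..<Suc k}. f (unit_vector R m j) i \<otimes> v j)"
    using closed[OF e] v km by (subst lessThan_Suc, subst finsum_insert) auto
  finally show ?case .
qed

lemma UGN_iff_not_identity_factors:
  assumes "ring S"
  shows "UGN S \<longleftrightarrow> (\<forall>n::nat>0. \<not> identity_factors S {..<n + 1} {..<n})"
proof -
  interpret ring S by fact
  have "(\<exists>f\<in>free_right_hom S n (n + 1). f ` free_carrier S n = free_carrier S (n + 1))
      \<longleftrightarrow> identity_factors S {..<n + 1} {..<n}" for n
  proof
    assume "\<exists>f\<in>free_right_hom S n (n + 1). f ` free_carrier S n = free_carrier S (n + 1)"
    then obtain f where f: "f \<in> free_right_hom S n (n + 1)"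
      and surj: "f ` free_carrier S n = free_carrier S (n + 1)"
      by blast
    have e: "unit_vector S m j \<in> free_carrier S m" for m j
      by (auto simp: unit_vector_def free_carrier_def)
    have "\<exists>b. b \<in> free_carrier S n \<and> f b = unit_vector S (n + 1) k" for k
      using surj e[of "n + 1" k] by (metis (no_types, lifting) imageE)
    then obtain b where b: "\<And>k. b k \<in> free_carrier S n"
      and fb: "\<And>k. f (b k) = unit_vector S (n + 1) k"
      by metis
    define A where "A i j = f (unit_vector S n j) i" for i j
    define B where "B j k = b k j" for j k
    have "A i j \<in> carrier S" if "i < n + 1" for i j
      unfolding A_def using free_carrierD[OF free_right_hom_closed[OF f e] that] .
    moreover have "B j k \<in> carrier S" if "j < n" for j k
      using b that by (auto simp: B_def free_carrier_def PiE_iff)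
    moreover have "(\<Oplus>\<^bsub>S\<^esub>j\<in>{..<n}. A i j \<otimes>\<^bsub>S\<^esub> B j k) = (if i = k then \<one>\<^bsub>S\<^esub> else \<zero>\<^bsub>S\<^esub>)"
      if "i < n + 1" for i k
      using free_right_hom_entry[OF f that order.refl b, of k] that
      by (simp add: fb A_def B_def unit_vector_def)
    ultimately show "identity_factors S {..<n + 1} {..<n}"
      unfolding identity_factors_def by blast
  next
    assume "identity_factors S {..<n + 1} {..<n}"
    then obtain A B where
      "\<forall>i\<in>{..<n + 1}. \<forall>j\<in>{..<n}. A i j \<in> carrier S \<and> B j i \<in> carrier S"
      "\<forall>i\<in>{..<n + 1}. \<forall>k\<in>{..<n + 1}.
        (\<Oplus>\<^bsub>S\<^esub>j\<in>{..<n}. A i j \<otimes>\<^bsub>S\<^esub> B j k) = (if i = k then \<one>\<^bsub>S\<^esub> else \<zero>\<^bsub>S\<^esub>)"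
      unfolding identity_factors_def by (elim exE conjE) (rule that)
    then have A: "\<And>i j. i < n + 1 \<Longrightarrow> j < n \<Longrightarrow> A i j \<in> carrier S"
      and B: "\<And>i j. i < n + 1 \<Longrightarrow> j < n \<Longrightarrow> B j i \<in> carrier S"
      and one: "\<And>i k. i < n + 1 \<Longrightarrow> k < n + 1 \<Longrightarrow>
        (\<Oplus>\<^bsub>S\<^esub>j\<in>{..<n}. A i j \<otimes>\<^bsub>S\<^esub> B j k) = (if i = k then \<one>\<^bsub>S\<^esub> else \<zero>\<^bsub>S\<^esub>)"
      by (simp_all only: lessThan_iff Ball_def)
    define f where "f v = (\<lambda>i\<in>{..<n + 1}. \<Oplus>\<^bsub>S\<^esub>j\<in>{..<n}. A i j \<otimes>\<^bsub>S\<^esub> v j)" for v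
    have f_closed: "f v \<in> free_carrier S (n + 1)" if "v \<in> free_carrier S n" for v
      using that A by (auto simp: f_def free_carrier_def PiE_iff intro!: finsum_closed)
    have "f \<in> free_right_hom S n (n + 1)"
      unfolding free_right_hom_def
    proof (intro CollectI conjI ballI)
      show "f \<in> free_carrier S n \<rightarrow> free_carrier S (n + 1)"
        using f_closed by blast
    next
      fix v w assume v: "v \<in> free_carrier S n" and w: "w \<in> free_carrier S n"
      have "(\<Oplus>\<^bsub>S\<^esub>j\<in>{..<n}. A i j \<otimes>\<^bsub>S\<^esub> free_add S n v w j)
          = (\<Oplus>\<^bsub>S\<^esub>j\<in>{..<n}. A i j \<otimes>\<^bsub>S\<^esub> v j) \<oplus>\<^bsub>S\<^esub> (\<Oplus>\<^bsub>S\<^esub>j\<in>{..<n}. A i j \<otimes>\<^bsub>S\<^esub> w j)"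
        if i: "i < n + 1" for i
      proof -
        have "(\<Oplus>\<^bsub>S\<^esub>j\<in>{..<n}. A i j \<otimes>\<^bsub>S\<^esub> free_add S n v w j)
            = (\<Oplus>\<^bsub>S\<^esub>j\<in>{..<n}. A i j \<otimes>\<^bsub>S\<^esub> v j \<oplus>\<^bsub>S\<^esub> A i j \<otimes>\<^bsub>S\<^esub> w j)"
          using v w A i
          by (intro finsum_cong' refl) (auto simp: free_add_def free_carrier_def PiE_iff r_distr)
        also have "\<dots> = (\<Oplus>\<^bsub>S\<^esub>j\<in>{..<n}. A i j \<otimes>\<^bsub>S\<^esub> v j) \<oplus>\<^bsub>S\<^esub> (\<Oplus>\<^bsub>S\<^esub>j\<in>{..<n}. A i j \<otimes>\<^bsub>S\<^esub> w j)"
          using v w A i by (intro finsum_addf) (auto simp: free_carrier_def PiE_iff)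
        finally show ?thesis .
      qed
      then show "f (free_add S n v w) = free_add S (n + 1) (f v) (f w)"
        by (auto simp: f_def free_add_def fun_eq_iff)
    next
      fix v s assume v: "v \<in> free_carrier S n" and s: "s \<in> carrier S"
      have "(\<Oplus>\<^bsub>S\<^esub>j\<in>{..<n}. A i j \<otimes>\<^bsub>S\<^esub> free_rscale S n v s j)
          = (\<Oplus>\<^bsub>S\<^esub>j\<in>{..<n}. A i j \<otimes>\<^bsub>S\<^esub> v j) \<otimes>\<^bsub>S\<^esub> s"
        if i: "i < n + 1" for i
      proof -
        have "(\<Oplus>\<^bsub>S\<^esub>j\<in>{..<n}. A i j \<otimes>\<^bsub>S\<^esub> free_rscale S n v s j)
            = (\<Oplus>\<^bsub>S\<^esub>j\<in>{..<n}. (A i j \<otimes>\<^bsub>S\<^esub> v j) \<otimes>\<^bsub>S\<^esub> s)"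
          using v s A i
          by (intro finsum_cong' refl) (auto simp: free_rscale_def free_carrier_def PiE_iff m_assoc)
        also have "\<dots> = (\<Oplus>\<^bsub>S\<^esub>j\<in>{..<n}. A i j \<otimes>\<^bsub>S\<^esub> v j) \<otimes>\<^bsub>S\<^esub> s"
          using v s A i by (intro finsum_ldistr[symmetric]) (auto simp: free_carrier_def PiE_iff)
        finally show ?thesis .
      qed
      then show "f (free_rscale S n v s) = free_rscale S (n + 1) (f v) s"
        by (auto simp: f_def free_rscale_def fun_eq_iff)
    qed
    moreover have "w \<in> f ` free_carrier S n" if w: "w \<in> free_carrier S (n + 1)" for w
    proof -
      have wc: "w k \<in> carrier S" if "k < n + 1" for k
        using w that by (auto simp: free_carrier_def PiE_iff)
      define v where "v = (\<lambda>j\<in>{..<n}. \<Oplus>\<^bsub>S\<^esub>k\<in>{..<n + 1}. B j k \<otimes>\<^bsub>S\<^esub> w k)"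
      have v: "v \<in> free_carrier S n"
        using B wc by (auto simp: v_def free_carrier_def simp del: One_nat_def add_Suc_right
            intro!: finsum_closed)
      have "f v i = w i" if i: "i < n + 1" for i
      proof -
        have "f v i = (\<Oplus>\<^bsub>S\<^esub>j\<in>{..<n}. A i j \<otimes>\<^bsub>S\<^esub> v j)"
          using i by (simp add: f_def)
        also have "\<dots> = (\<Oplus>\<^bsub>S\<^esub>j\<in>{..<n}. \<Oplus>\<^bsub>S\<^esub>k\<in>{..<n + 1}. A i j \<otimes>\<^bsub>S\<^esub> B j k \<otimes>\<^bsub>S\<^esub> w k)"
        proof (intro finsum_cong' refl Pi_I)
          fix j assume "j \<in> {..<n}"
          then have j: "j < n" by simp
          have "A i j \<otimes>\<^bsub>S\<^esub> v j = (\<Oplus>\<^bsub>S\<^esub>k\<in>{..<n + 1}. A i j \<otimes>\<^bsub>S\<^esub> (B j k \<otimes>\<^bsub>S\<^esub> w k))"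
            using i j A B wc by (simp add: v_def del: One_nat_def add_Suc_right)
              (intro finsum_rdistr, auto)
          also have "\<dots> = (\<Oplus>\<^bsub>S\<^esub>k\<in>{..<n + 1}. A i j \<otimes>\<^bsub>S\<^esub> B j k \<otimes>\<^bsub>S\<^esub> w k)"
            using i j A B wc by (intro finsum_cong' refl) (auto simp: m_assoc)
          finally show "A i j \<otimes>\<^bsub>S\<^esub> v j = (\<Oplus>\<^bsub>S\<^esub>k\<in>{..<n + 1}. A i j \<otimes>\<^bsub>S\<^esub> B j k \<otimes>\<^bsub>S\<^esub> w k)" .
          show "(\<Oplus>\<^bsub>S\<^esub>k\<in>{..<n + 1}. A i j \<otimes>\<^bsub>S\<^esub> B j k \<otimes>\<^bsub>S\<^esub> w k) \<in> carrier S"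
            using i j A B wc by (intro finsum_closed) auto
        qed
        also have "\<dots> = (\<Oplus>\<^bsub>S\<^esub>k\<in>{..<n + 1}. \<Oplus>\<^bsub>S\<^esub>j\<in>{..<n}. A i j \<otimes>\<^bsub>S\<^esub> B j k \<otimes>\<^bsub>S\<^esub> w k)"
          using i A B wc by (intro finsum_swap) auto
        also have "\<dots> = (\<Oplus>\<^bsub>S\<^esub>k\<in>{..<n + 1}. if k = i then w i else \<zero>\<^bsub>S\<^esub>)"
        proof (intro finsum_cong' refl Pi_I)
          fix k assume "k \<in> {..<n + 1}"
          then have k: "k < n + 1" by simp
          have "(\<Oplus>\<^bsub>S\<^esub>j\<in>{..<n}. A i j \<otimes>\<^bsub>S\<^esub> B j k \<otimes>\<^bsub>S\<^esub> w k)
              = (\<Oplus>\<^bsub>S\<^esub>j\<in>{..<n}. A i j \<otimes>\<^bsub>S\<^esub> B j k) \<otimes>\<^bsub>S\<^esub> w k"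
            using i k A B wc by (intro finsum_ldistr[symmetric]) auto
          then show "(\<Oplus>\<^bsub>S\<^esub>j\<in>{..<n}. A i j \<otimes>\<^bsub>S\<^esub> B j k \<otimes>\<^bsub>S\<^esub> w k) = (if k = i then w i else \<zero>\<^bsub>S\<^esub>)"
            using one[OF i k] wc[OF k] by auto
        qed (use wc i in auto)
        also have "\<dots> = w i"
          using i wc by (subst finsum_single[where a = i]) auto
        finally show ?thesis .
      qed
      then have "f v = w"
        using f_closed[OF v] w unfolding free_carrier_def by (intro PiE_ext) auto
      then show ?thesis
        using v by blast
    qed
    ultimately show "\<exists>f\<in>free_right_hom S n (n + 1). f ` free_carrier S n = free_carrier S (n + 1)"
      using f_closed by (intro bexI[of _ f]) auto
  qed
  then show ?thesis
    unfolding UGN_def by (simp only:)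
qed

text \<open>
  A surjection \<open>S\<^sup>n \<rightarrow> S\<^sup>n\<^sup>+\<^sup>1\<close> is then impossible for reasons of cardinality.
\<close>

lemma UGN_if_finite:
  assumes "finite (carrier S)" "card (carrier S) > 1"
  shows "UGN S"
proof -
  have "card (free_carrier S n) < card (free_carrier S (n + 1))" for n
    using assms by (simp add: free_carrier_def card_PiE)
  moreover have "finite (free_carrier S n)" for n
    using assms by (auto simp: free_carrier_def intro: finite_PiE)
  ultimately show ?thesis
    unfolding UGN_def by (metis card_image_le leD)
qed

text \<open>
  The field with two elements, realized on two distinct elements \<open>a\<close> (zero) and \<open>b\<close> (one).
\<close>

definition two_element_ring :: "'r \<Rightarrow> 'r \<Rightarrow> 'r ring" where
  "two_element_ring a b =
     \<lparr>carrier = {a, b}, mult = (\<lambda>x y. if x = b then y else a), one = b,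
      zero = a, add = (\<lambda>x y. if x = y then a else b)\<rparr>"

lemma ring_two_element_ring:
  assumes "a \<noteq> b"
  shows "ring (two_element_ring a b)"
  by (intro ringI abelian_groupI monoidI)
    (use assms in \<open>auto simp: two_element_ring_def split: if_splits\<close>)

lemma UGN_two_element_ring:
  assumes "a \<noteq> b"
  shows "UGN (two_element_ring a b)"
  using assms by (intro UGN_if_finite) (auto simp: two_element_ring_def)

section \<open>The translation ring\<close>

text \<open>
  A group and a ring on unrelated types, as needed for the translation ring, which is abbreviated by \<open>T\<close>.
\<close>

locale group_and_ring = G: group G + R: ring R
  for G :: "('g, 'b) monoid_scheme" and R :: "('r, 'c) ring_scheme"
begin

abbreviation T :: "('g \<times> 'g \<Rightarrow> 'r) ring" where
  "T \<equiv> translation_ring G R"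

lemma carrier_T: "carrier T = translation_carrier G R"
  by (simp add: translation_ring_def)

lemma T_closed: "M \<in> carrier T \<Longrightarrow> x \<in> carrier G \<Longrightarrow> y \<in> carrier G \<Longrightarrow> M (x, y) \<in> carrier R"
  by (auto simp: carrier_T translation_carrier_def)

lemma T_eqI:
  assumes "M \<in> carrier T" "N \<in> carrier T"
    and "\<And>x y. x \<in> carrier G \<Longrightarrow> y \<in> carrier G \<Longrightarrow> M (x, y) = N (x, y)"
  shows "M = N"
  using assms unfolding carrier_T translation_carrier_def by (intro PiE_ext) auto

lemma T_carrierI:
  assumes "finite K" "K \<subseteq> carrier G"
    and "\<And>x y. x \<in> carrier G \<Longrightarrow> y \<in> carrier G \<Longrightarrow> f x y \<in> carrier R"
    and "\<And>x y. x \<in> carrier G \<Longrightarrow> y \<in> carrier G \<Longrightarrow> y \<notin> K #>\<^bsub>G\<^esub> x \<Longrightarrow> f x y = \<zero>\<^bsub>R\<^esub>"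
  shows "(\<lambda>(x, y)\<in>carrier G \<times> carrier G. f x y) \<in> carrier T"
  using assms unfolding carrier_T translation_carrier_def by auto

text \<open>
  The support of a matrix lies in a band \<open>y \<in> K x\<close>; in particular each row is finitely supported.
\<close>

lemma T_carrierE:
  assumes "M \<in> carrier T"
  obtains K where "finite K" "K \<subseteq> carrier G"
    "\<And>x y. x \<in> carrier G \<Longrightarrow> y \<in> carrier G \<Longrightarrow> y \<notin> K #>\<^bsub>G\<^esub> x \<Longrightarrow> M (x, y) = \<zero>\<^bsub>R\<^esub>"
  using assms unfolding carrier_T translation_carrier_def by blast

lemma finite_row:
  assumes "M \<in> carrier T" "x \<in> carrier G"
  shows "finite {z \<in> carrier G. M (x, z) \<noteq> \<zero>\<^bsub>R\<^esub>}"
proof -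
  obtain K where K: "finite K"
    "\<And>x y. x \<in> carrier G \<Longrightarrow> y \<in> carrier G \<Longrightarrow> y \<notin> K #>\<^bsub>G\<^esub> x \<Longrightarrow> M (x, y) = \<zero>\<^bsub>R\<^esub>"
    using T_carrierE[OF assms(1)] by metis
  have "{z \<in> carrier G. M (x, z) \<noteq> \<zero>\<^bsub>R\<^esub>} \<subseteq> K #>\<^bsub>G\<^esub> x"
    using K(2) assms(2) by blast
  moreover have "finite (K #>\<^bsub>G\<^esub> x)"
    using K(1) by (simp add: r_coset_def)
  ultimately show ?thesis
    by (rule finite_subset)
qed

lemma zero_T_entry: "x \<in> carrier G \<Longrightarrow> y \<in> carrier G \<Longrightarrow> \<zero>\<^bsub>T\<^esub> (x, y) = \<zero>\<^bsub>R\<^esub>"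
  and one_T_entry: "x \<in> carrier G \<Longrightarrow> y \<in> carrier G \<Longrightarrow>
    \<one>\<^bsub>T\<^esub> (x, y) = (if x = y then \<one>\<^bsub>R\<^esub> else \<zero>\<^bsub>R\<^esub>)"
  and add_T_entry: "x \<in> carrier G \<Longrightarrow> y \<in> carrier G \<Longrightarrow>
    (M \<oplus>\<^bsub>T\<^esub> N) (x, y) = M (x, y) \<oplus>\<^bsub>R\<^esub> N (x, y)"
  by (simp_all add: translation_ring_def)

text \<open>
  The sum over the support of the product may be replaced by a sum over any finite set that contains the
  support of row \<open>x\<close> of the left factor. The ring axioms reduce to finite sums in this way.
\<close>

lemma mult_T_entry:
  assumes M: "M \<in> carrier T" and N: "N \<in> carrier T" and xy: "x \<in> carrier G" "y \<in> carrier G"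
    and Z: "finite Z" "Z \<subseteq> carrier G" "\<And>z. z \<in> carrier G \<Longrightarrow> z \<notin> Z \<Longrightarrow> M (x, z) = \<zero>\<^bsub>R\<^esub>"
  shows "(M \<otimes>\<^bsub>T\<^esub> N) (x, y) = (\<Oplus>\<^bsub>R\<^esub>z\<in>Z. M (x, z) \<otimes>\<^bsub>R\<^esub> N (z, y))"
proof -
  let ?S = "{z \<in> carrier G. M (x, z) \<otimes>\<^bsub>R\<^esub> N (z, y) \<noteq> \<zero>\<^bsub>R\<^esub>}"
  have "?S \<subseteq> Z"
  proof
    fix z assume z: "z \<in> ?S"
    show "z \<in> Z"
    proof (rule ccontr)
      assume "z \<notin> Z"
      then have "M (x, z) \<otimes>\<^bsub>R\<^esub> N (z, y) = \<zero>\<^bsub>R\<^esub>"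
        using z Z(3) T_closed[OF N _ xy(2)] by simp
      with z show False by simp
    qed
  qed
  then have "(\<Oplus>\<^bsub>R\<^esub>z\<in>?S. M (x, z) \<otimes>\<^bsub>R\<^esub> N (z, y)) = (\<Oplus>\<^bsub>R\<^esub>z\<in>Z. M (x, z) \<otimes>\<^bsub>R\<^esub> N (z, y))"
  proof (rule R.finsum_superset[OF Z(1)])
    fix z
    show "M (x, z) \<otimes>\<^bsub>R\<^esub> N (z, y) \<in> carrier R" if "z \<in> ?S"
      using that T_closed[OF M xy(1)] T_closed[OF N _ xy(2)] by simp
    show "M (x, z) \<otimes>\<^bsub>R\<^esub> N (z, y) = \<zero>\<^bsub>R\<^esub>" if "z \<in> Z - ?S"
      using that Z(2) by blast
  qed
  then show ?thesis
    using xy by (simp add: translation_ring_def)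
qed

lemma zero_T_closed: "\<zero>\<^bsub>T\<^esub> \<in> carrier T"
proof -
  have "\<zero>\<^bsub>T\<^esub> = (\<lambda>(x, y)\<in>carrier G \<times> carrier G. \<zero>\<^bsub>R\<^esub>)"
    by (auto simp: translation_ring_def)
  then show ?thesis
    using T_carrierI[of "{}" "\<lambda>_ _. \<zero>\<^bsub>R\<^esub>"] by simp
qed

lemma one_T_closed: "\<one>\<^bsub>T\<^esub> \<in> carrier T"
proof -
  have "\<one>\<^bsub>T\<^esub> = (\<lambda>(x, y)\<in>carrier G \<times> carrier G. if x = y then \<one>\<^bsub>R\<^esub> else \<zero>\<^bsub>R\<^esub>)"
    by (simp add: translation_ring_def)
  also have "\<dots> \<in> carrier T"
    by (rule T_carrierI[of "{\<one>\<^bsub>G\<^esub>}"]) (auto simp: r_coset_def)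
  finally show ?thesis .
qed

lemma add_T_closed:
  assumes M: "M \<in> carrier T" and N: "N \<in> carrier T"
  shows "M \<oplus>\<^bsub>T\<^esub> N \<in> carrier T"
proof -
  obtain K where K: "finite K" "K \<subseteq> carrier G"
    "\<And>x y. x \<in> carrier G \<Longrightarrow> y \<in> carrier G \<Longrightarrow> y \<notin> K #>\<^bsub>G\<^esub> x \<Longrightarrow> M (x, y) = \<zero>\<^bsub>R\<^esub>"
    using T_carrierE[OF M] by metis
  obtain L where L: "finite L" "L \<subseteq> carrier G"
    "\<And>x y. x \<in> carrier G \<Longrightarrow> y \<in> carrier G \<Longrightarrow> y \<notin> L #>\<^bsub>G\<^esub> x \<Longrightarrow> N (x, y) = \<zero>\<^bsub>R\<^esub>"
    using T_carrierE[OF N] by metis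
  have "M \<oplus>\<^bsub>T\<^esub> N = (\<lambda>(x, y)\<in>carrier G \<times> carrier G. M (x, y) \<oplus>\<^bsub>R\<^esub> N (x, y))"
    by (auto simp: translation_ring_def)
  also have "\<dots> \<in> carrier T"
  proof (rule T_carrierI[of "K \<union> L"])
    fix x y assume xy: "x \<in> carrier G" "y \<in> carrier G" "y \<notin> (K \<union> L) #>\<^bsub>G\<^esub> x"
    then have "y \<notin> K #>\<^bsub>G\<^esub> x" "y \<notin> L #>\<^bsub>G\<^esub> x"
      by (auto simp: r_coset_def)
    then show "M (x, y) \<oplus>\<^bsub>R\<^esub> N (x, y) = \<zero>\<^bsub>R\<^esub>"
      using K(3) L(3) xy by simp
  qed (use K L T_closed[OF M] T_closed[OF N] in auto)
  finally show ?thesis .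
qed

lemma mult_T_closed:
  assumes M: "M \<in> carrier T" and N: "N \<in> carrier T"
  shows "M \<otimes>\<^bsub>T\<^esub> N \<in> carrier T"
proof -
  obtain K where K: "finite K" "K \<subseteq> carrier G"
    "\<And>x y. x \<in> carrier G \<Longrightarrow> y \<in> carrier G \<Longrightarrow> y \<notin> K #>\<^bsub>G\<^esub> x \<Longrightarrow> M (x, y) = \<zero>\<^bsub>R\<^esub>"
    using T_carrierE[OF M] by metis
  obtain L where L: "finite L" "L \<subseteq> carrier G"
    "\<And>x y. x \<in> carrier G \<Longrightarrow> y \<in> carrier G \<Longrightarrow> y \<notin> L #>\<^bsub>G\<^esub> x \<Longrightarrow> N (x, y) = \<zero>\<^bsub>R\<^esub>"
    using T_carrierE[OF N] by metis
  have entry: "(M \<otimes>\<^bsub>T\<^esub> N) (x, y) = (\<Oplus>\<^bsub>R\<^esub>z\<in>K #>\<^bsub>G\<^esub> x. M (x, z) \<otimes>\<^bsub>R\<^esub> N (z, y))"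
    if "x \<in> carrier G" "y \<in> carrier G" for x y
  proof (rule mult_T_entry[OF M N that])
    show "finite (K #>\<^bsub>G\<^esub> x)"
      using K by (simp add: r_coset_def)
    show "K #>\<^bsub>G\<^esub> x \<subseteq> carrier G"
      using K that G.r_coset_subset_G by blast
  qed (use K that in auto)
  have "M \<otimes>\<^bsub>T\<^esub> N = (\<lambda>(x, y)\<in>carrier G \<times> carrier G. (M \<otimes>\<^bsub>T\<^esub> N) (x, y))"
    by (auto simp: translation_ring_def)
  also have "\<dots> \<in> carrier T"
  proof (rule T_carrierI[of "L <#>\<^bsub>G\<^esub> K"])
    fix x y assume xy: "x \<in> carrier G" "y \<in> carrier G"
    have cosets: "z \<in> carrier G" if "z \<in> K #>\<^bsub>G\<^esub> x" for z
      using that K xy G.r_coset_subset_G by blast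
    show "(M \<otimes>\<^bsub>T\<^esub> N) (x, y) \<in> carrier R"
      unfolding entry[OF xy]
      using cosets T_closed[OF M] T_closed[OF N] xy by (intro R.finsum_closed) auto
    assume y: "y \<notin> (L <#>\<^bsub>G\<^esub> K) #>\<^bsub>G\<^esub> x"
    have "M (x, z) \<otimes>\<^bsub>R\<^esub> N (z, y) = \<zero>\<^bsub>R\<^esub>" if z: "z \<in> K #>\<^bsub>G\<^esub> x" for z
    proof -
      have "y \<notin> L #>\<^bsub>G\<^esub> z"
      proof
        assume "y \<in> L #>\<^bsub>G\<^esub> z"
        then obtain k l where kl: "k \<in> K" "l \<in> L" "y = l \<otimes>\<^bsub>G\<^esub> (k \<otimes>\<^bsub>G\<^esub> x)"
          using z by (auto simp: r_coset_def)
        then have "y = (l \<otimes>\<^bsub>G\<^esub> k) \<otimes>\<^bsub>G\<^esub> x"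
          using K L xy by (simp add: G.m_assoc subset_eq)
        moreover have "l \<otimes>\<^bsub>G\<^esub> k \<in> L <#>\<^bsub>G\<^esub> K"
          using kl(1,2) by (auto simp: set_mult_def)
        ultimately have "y \<in> (L <#>\<^bsub>G\<^esub> K) #>\<^bsub>G\<^esub> x"
          unfolding r_coset_def by blast
        with y show False by contradiction
      qed
      then show ?thesis
        using L(3)[OF cosets[OF z] xy(2)] T_closed[OF M xy(1) cosets[OF z]] by simp
    qed
    then show "(M \<otimes>\<^bsub>T\<^esub> N) (x, y) = \<zero>\<^bsub>R\<^esub>"
      unfolding entry[OF xy] by (rule R.add.finprod_one_eqI)
  next
    show "finite (L <#>\<^bsub>G\<^esub> K)"
      using K L by (auto simp: set_mult_def)
    show "L <#>\<^bsub>G\<^esub> K \<subseteq> carrier G"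
      using K L by (intro G.setmult_subset_G)
  qed
  finally show ?thesis .
qed

lemma mult_T_assoc:
  assumes L: "L \<in> carrier T" and M: "M \<in> carrier T" and N: "N \<in> carrier T"
  shows "(L \<otimes>\<^bsub>T\<^esub> M) \<otimes>\<^bsub>T\<^esub> N = L \<otimes>\<^bsub>T\<^esub> (M \<otimes>\<^bsub>T\<^esub> N)"
proof (rule T_eqI)
  fix x y assume xy: "x \<in> carrier G" "y \<in> carrier G"
  define Z where "Z = {z \<in> carrier G. L (x, z) \<noteq> \<zero>\<^bsub>R\<^esub>}"
  define W where "W = {w \<in> carrier G. (L \<otimes>\<^bsub>T\<^esub> M) (x, w) \<noteq> \<zero>\<^bsub>R\<^esub>}
    \<union> (\<Union>z\<in>Z. {w \<in> carrier G. M (z, w) \<noteq> \<zero>\<^bsub>R\<^esub>})"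
  have Z: "finite Z" "Z \<subseteq> carrier G"
    using finite_row[OF L xy(1)] by (auto simp: Z_def)
  have W: "finite W" "W \<subseteq> carrier G"
    using finite_row[OF mult_T_closed[OF L M] xy(1)] finite_row[OF M] Z by (auto simp: W_def)
  have closed: "L (x, z) \<in> carrier R" "M (z, w) \<in> carrier R" "N (w, y) \<in> carrier R"
    if "z \<in> Z" "w \<in> W" for z w
  proof -
    have "z \<in> carrier G" "w \<in> carrier G"
      using that Z W by blast+
    then show "L (x, z) \<in> carrier R" "M (z, w) \<in> carrier R" "N (w, y) \<in> carrier R"
      using xy by (simp_all add: T_closed[OF L] T_closed[OF M] T_closed[OF N])
  qed
  have "((L \<otimes>\<^bsub>T\<^esub> M) \<otimes>\<^bsub>T\<^esub> N) (x, y) = (\<Oplus>\<^bsub>R\<^esub>w\<in>W. (L \<otimes>\<^bsub>T\<^esub> M) (x, w) \<otimes>\<^bsub>R\<^esub> N (w, y))"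
    by (rule mult_T_entry[OF mult_T_closed[OF L M] N xy W]) (auto simp: W_def)
  also have "\<dots> = (\<Oplus>\<^bsub>R\<^esub>w\<in>W. \<Oplus>\<^bsub>R\<^esub>z\<in>Z. L (x, z) \<otimes>\<^bsub>R\<^esub> (M (z, w) \<otimes>\<^bsub>R\<^esub> N (w, y)))"
  proof (intro R.finsum_cong' refl Pi_I)
    fix w assume w: "w \<in> W"
    then have "N (w, y) \<in> carrier R"
      using W xy T_closed[OF N] by auto
    moreover have "(L \<otimes>\<^bsub>T\<^esub> M) (x, w) = (\<Oplus>\<^bsub>R\<^esub>z\<in>Z. L (x, z) \<otimes>\<^bsub>R\<^esub> M (z, w))"
      using w W by (intro mult_T_entry[OF L M xy(1) _ Z]) (auto simp: Z_def)
    ultimately have "(L \<otimes>\<^bsub>T\<^esub> M) (x, w) \<otimes>\<^bsub>R\<^esub> N (w, y)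
        = (\<Oplus>\<^bsub>R\<^esub>z\<in>Z. (L (x, z) \<otimes>\<^bsub>R\<^esub> M (z, w)) \<otimes>\<^bsub>R\<^esub> N (w, y))"
      using closed w Z by (simp add: R.finsum_ldistr)
    also have "\<dots> = (\<Oplus>\<^bsub>R\<^esub>z\<in>Z. L (x, z) \<otimes>\<^bsub>R\<^esub> (M (z, w) \<otimes>\<^bsub>R\<^esub> N (w, y)))"
      by (rule R.finsum_cong') (use closed[OF _ w] in \<open>auto simp: R.m_assoc\<close>)
    finally show "(L \<otimes>\<^bsub>T\<^esub> M) (x, w) \<otimes>\<^bsub>R\<^esub> N (w, y)
        = (\<Oplus>\<^bsub>R\<^esub>z\<in>Z. L (x, z) \<otimes>\<^bsub>R\<^esub> (M (z, w) \<otimes>\<^bsub>R\<^esub> N (w, y)))" .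
    show "(\<Oplus>\<^bsub>R\<^esub>z\<in>Z. L (x, z) \<otimes>\<^bsub>R\<^esub> (M (z, w) \<otimes>\<^bsub>R\<^esub> N (w, y))) \<in> carrier R"
      by (rule R.finsum_closed) (use closed[OF _ w] in auto)
  qed
  also have "\<dots> = (\<Oplus>\<^bsub>R\<^esub>z\<in>Z. \<Oplus>\<^bsub>R\<^esub>w\<in>W. L (x, z) \<otimes>\<^bsub>R\<^esub> (M (z, w) \<otimes>\<^bsub>R\<^esub> N (w, y)))"
    using closed by (intro R.finsum_swap W Z) auto
  also have "\<dots> = (\<Oplus>\<^bsub>R\<^esub>z\<in>Z. L (x, z) \<otimes>\<^bsub>R\<^esub> (M \<otimes>\<^bsub>T\<^esub> N) (z, y))"
  proof (intro R.finsum_cong' refl Pi_I)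
    fix z assume z: "z \<in> Z"
    then have zG: "z \<in> carrier G"
      using Z by blast
    show "L (x, z) \<otimes>\<^bsub>R\<^esub> (M \<otimes>\<^bsub>T\<^esub> N) (z, y) \<in> carrier R"
      using T_closed[OF L xy(1) zG] T_closed[OF mult_T_closed[OF M N] zG xy(2)] by simp
    have "(M \<otimes>\<^bsub>T\<^esub> N) (z, y) = (\<Oplus>\<^bsub>R\<^esub>w\<in>W. M (z, w) \<otimes>\<^bsub>R\<^esub> N (w, y))"
      using z by (intro mult_T_entry[OF M N zG xy(2) W]) (auto simp: W_def)
    then show "(\<Oplus>\<^bsub>R\<^esub>w\<in>W. L (x, z) \<otimes>\<^bsub>R\<^esub> (M (z, w) \<otimes>\<^bsub>R\<^esub> N (w, y)))
        = L (x, z) \<otimes>\<^bsub>R\<^esub> (M \<otimes>\<^bsub>T\<^esub> N) (z, y)"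
      using closed[OF z] W T_closed[OF L xy(1) zG] by (simp add: R.finsum_rdistr)
  qed
  also have "\<dots> = (L \<otimes>\<^bsub>T\<^esub> (M \<otimes>\<^bsub>T\<^esub> N)) (x, y)"
    by (rule mult_T_entry[OF L mult_T_closed[OF M N] xy Z, symmetric]) (auto simp: Z_def)
  finally show "((L \<otimes>\<^bsub>T\<^esub> M) \<otimes>\<^bsub>T\<^esub> N) (x, y) = (L \<otimes>\<^bsub>T\<^esub> (M \<otimes>\<^bsub>T\<^esub> N)) (x, y)" .
qed (intro mult_T_closed L M N)+

lemma diagonal_mult_entry:
  assumes M: "M \<in> carrier T" and N: "N \<in> carrier T" and xy: "x \<in> carrier G" "y \<in> carrier G"
    and diag: "\<And>z. z \<in> carrier G \<Longrightarrow> z \<noteq> x \<Longrightarrow> M (x, z) = \<zero>\<^bsub>R\<^esub>"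
  shows "(M \<otimes>\<^bsub>T\<^esub> N) (x, y) = M (x, x) \<otimes>\<^bsub>R\<^esub> N (x, y)"
proof -
  have "(M \<otimes>\<^bsub>T\<^esub> N) (x, y) = (\<Oplus>\<^bsub>R\<^esub>z\<in>{x}. M (x, z) \<otimes>\<^bsub>R\<^esub> N (z, y))"
    by (rule mult_T_entry[OF M N xy]) (use xy diag in auto)
  then show ?thesis
    using T_closed[OF M xy(1) xy(1)] T_closed[OF N xy] by simp
qed

lemma ring_T: "ring T"
proof (rule ringI)
  show "abelian_group T"
  proof (rule abelian_groupI)
    fix M assume M: "M \<in> carrier T"
    let ?N = "\<lambda>(x, y)\<in>carrier G \<times> carrier G. \<ominus>\<^bsub>R\<^esub> M (x, y)"
    obtain K where K: "finite K" "K \<subseteq> carrier G"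
      "\<And>x y. x \<in> carrier G \<Longrightarrow> y \<in> carrier G \<Longrightarrow> y \<notin> K #>\<^bsub>G\<^esub> x \<Longrightarrow> M (x, y) = \<zero>\<^bsub>R\<^esub>"
      using T_carrierE[OF M] by metis
    have N: "?N \<in> carrier T"
      by (rule T_carrierI[OF K(1,2)]) (simp_all add: K(3) T_closed[OF M])
    have "?N \<oplus>\<^bsub>T\<^esub> M = \<zero>\<^bsub>T\<^esub>"
      by (rule T_eqI[OF add_T_closed[OF N M] zero_T_closed])
        (simp add: add_T_entry zero_T_entry T_closed[OF M] R.l_neg)
    then show "\<exists>N\<in>carrier T. N \<oplus>\<^bsub>T\<^esub> M = \<zero>\<^bsub>T\<^esub>"
      using N by blast
    show "\<zero>\<^bsub>T\<^esub> \<oplus>\<^bsub>T\<^esub> M = M"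
      by (rule T_eqI[OF add_T_closed[OF zero_T_closed M] M])
        (simp add: add_T_entry zero_T_entry T_closed[OF M])
  next
    fix L M N assume L: "L \<in> carrier T" and M: "M \<in> carrier T" and N: "N \<in> carrier T"
    show "(L \<oplus>\<^bsub>T\<^esub> M) \<oplus>\<^bsub>T\<^esub> N = L \<oplus>\<^bsub>T\<^esub> (M \<oplus>\<^bsub>T\<^esub> N)"
      by (rule T_eqI)
        (simp_all add: L M N add_T_closed add_T_entry T_closed[OF L] T_closed[OF M] T_closed[OF N] R.a_assoc)
  next
    fix M N assume M: "M \<in> carrier T" and N: "N \<in> carrier T"
    show "M \<oplus>\<^bsub>T\<^esub> N = N \<oplus>\<^bsub>T\<^esub> M"
      by (rule T_eqI)
        (simp_all add: M N add_T_closed add_T_entry T_closed[OF M] T_closed[OF N] R.a_comm)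
    show "M \<oplus>\<^bsub>T\<^esub> N \<in> carrier T"
      by (rule add_T_closed[OF M N])
  qed (rule zero_T_closed)
next
  show "monoid T"
  proof (rule monoidI)
    fix M assume M: "M \<in> carrier T"
    show "\<one>\<^bsub>T\<^esub> \<otimes>\<^bsub>T\<^esub> M = M"
    proof (rule T_eqI[OF mult_T_closed[OF one_T_closed M] M])
      fix x y assume xy: "x \<in> carrier G" "y \<in> carrier G"
      show "(\<one>\<^bsub>T\<^esub> \<otimes>\<^bsub>T\<^esub> M) (x, y) = M (x, y)"
        by (subst diagonal_mult_entry[OF one_T_closed M xy])
          (use xy T_closed[OF M xy] in \<open>auto simp: one_T_entry\<close>)
    qed
    show "M \<otimes>\<^bsub>T\<^esub> \<one>\<^bsub>T\<^esub> = M"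
    proof (rule T_eqI[OF mult_T_closed[OF M one_T_closed] M])
      fix x y assume xy: "x \<in> carrier G" "y \<in> carrier G"
      define Z where "Z = insert y {z \<in> carrier G. M (x, z) \<noteq> \<zero>\<^bsub>R\<^esub>}"
      have Z: "finite Z" "Z \<subseteq> carrier G" "y \<in> Z"
        using finite_row[OF M xy(1)] xy by (auto simp: Z_def)
      have "(M \<otimes>\<^bsub>T\<^esub> \<one>\<^bsub>T\<^esub>) (x, y) = (\<Oplus>\<^bsub>R\<^esub>z\<in>Z. M (x, z) \<otimes>\<^bsub>R\<^esub> \<one>\<^bsub>T\<^esub> (z, y))"
        by (rule mult_T_entry[OF M one_T_closed xy Z(1,2)]) (auto simp: Z_def)
      also have "\<dots> = M (x, y) \<otimes>\<^bsub>R\<^esub> \<one>\<^bsub>T\<^esub> (y, y)"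
        by (rule R.finsum_single[OF Z(1,3)])
          (use Z(2) xy T_closed[OF M xy(1)] in \<open>auto simp: one_T_entry\<close>)
      finally show "(M \<otimes>\<^bsub>T\<^esub> \<one>\<^bsub>T\<^esub>) (x, y) = M (x, y)"
        using xy T_closed[OF M xy] by (simp add: one_T_entry)
    qed
  qed (simp_all add: mult_T_closed one_T_closed mult_T_assoc)
next
  fix L M N assume L: "L \<in> carrier T" and M: "M \<in> carrier T" and N: "N \<in> carrier T"
  show "(L \<oplus>\<^bsub>T\<^esub> M) \<otimes>\<^bsub>T\<^esub> N = L \<otimes>\<^bsub>T\<^esub> N \<oplus>\<^bsub>T\<^esub> M \<otimes>\<^bsub>T\<^esub> N"
  proof (rule T_eqI)
    fix x y assume xy: "x \<in> carrier G" "y \<in> carrier G"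
    define Z where "Z = {z \<in> carrier G. L (x, z) \<noteq> \<zero>\<^bsub>R\<^esub>} \<union> {z \<in> carrier G. M (x, z) \<noteq> \<zero>\<^bsub>R\<^esub>}"
    have Z: "finite Z" "Z \<subseteq> carrier G"
      using finite_row[OF L xy(1)] finite_row[OF M xy(1)] by (auto simp: Z_def)
    have closed: "L (x, z) \<in> carrier R" "M (x, z) \<in> carrier R" "N (z, y) \<in> carrier R"
      if "z \<in> Z" for z
      using that Z xy T_closed[OF L] T_closed[OF M] T_closed[OF N] by auto
    have "((L \<oplus>\<^bsub>T\<^esub> M) \<otimes>\<^bsub>T\<^esub> N) (x, y) = (\<Oplus>\<^bsub>R\<^esub>z\<in>Z. (L \<oplus>\<^bsub>T\<^esub> M) (x, z) \<otimes>\<^bsub>R\<^esub> N (z, y))"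
      by (rule mult_T_entry[OF add_T_closed[OF L M] N xy Z]) (auto simp: Z_def add_T_entry xy)
    also have "\<dots> = (\<Oplus>\<^bsub>R\<^esub>z\<in>Z. L (x, z) \<otimes>\<^bsub>R\<^esub> N (z, y) \<oplus>\<^bsub>R\<^esub> M (x, z) \<otimes>\<^bsub>R\<^esub> N (z, y))"
      by (rule R.finsum_cong')
        (use closed Z(2) xy in \<open>auto simp: add_T_entry R.l_distr subset_eq\<close>)
    also have "\<dots> = (\<Oplus>\<^bsub>R\<^esub>z\<in>Z. L (x, z) \<otimes>\<^bsub>R\<^esub> N (z, y)) \<oplus>\<^bsub>R\<^esub> (\<Oplus>\<^bsub>R\<^esub>z\<in>Z. M (x, z) \<otimes>\<^bsub>R\<^esub> N (z, y))"
      by (rule R.finsum_addf) (use closed in auto)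
    also have "(\<Oplus>\<^bsub>R\<^esub>z\<in>Z. L (x, z) \<otimes>\<^bsub>R\<^esub> N (z, y)) = (L \<otimes>\<^bsub>T\<^esub> N) (x, y)"
      by (rule mult_T_entry[OF L N xy Z, symmetric]) (auto simp: Z_def)
    also have "(\<Oplus>\<^bsub>R\<^esub>z\<in>Z. M (x, z) \<otimes>\<^bsub>R\<^esub> N (z, y)) = (M \<otimes>\<^bsub>T\<^esub> N) (x, y)"
      by (rule mult_T_entry[OF M N xy Z, symmetric]) (auto simp: Z_def)
    finally show "((L \<oplus>\<^bsub>T\<^esub> M) \<otimes>\<^bsub>T\<^esub> N) (x, y) = (L \<otimes>\<^bsub>T\<^esub> N \<oplus>\<^bsub>T\<^esub> M \<otimes>\<^bsub>T\<^esub> N) (x, y)"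
      by (simp add: add_T_entry xy)
  qed (simp_all add: L M N add_T_closed mult_T_closed)
  show "L \<otimes>\<^bsub>T\<^esub> (M \<oplus>\<^bsub>T\<^esub> N) = L \<otimes>\<^bsub>T\<^esub> M \<oplus>\<^bsub>T\<^esub> L \<otimes>\<^bsub>T\<^esub> N"
  proof (rule T_eqI)
    fix x y assume xy: "x \<in> carrier G" "y \<in> carrier G"
    define Z where "Z = {z \<in> carrier G. L (x, z) \<noteq> \<zero>\<^bsub>R\<^esub>}"
    have Z: "finite Z" "Z \<subseteq> carrier G"
      using finite_row[OF L xy(1)] by (auto simp: Z_def)
    have closed: "L (x, z) \<in> carrier R" "M (z, y) \<in> carrier R" "N (z, y) \<in> carrier R"
      if "z \<in> Z" for z
      using that Z xy T_closed[OF L] T_closed[OF M] T_closed[OF N] by auto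
    have entry: "(L \<otimes>\<^bsub>T\<^esub> X) (x, y) = (\<Oplus>\<^bsub>R\<^esub>z\<in>Z. L (x, z) \<otimes>\<^bsub>R\<^esub> X (z, y))" if "X \<in> carrier T" for X
      by (rule mult_T_entry[OF L that xy Z]) (auto simp: Z_def)
    have "(L \<otimes>\<^bsub>T\<^esub> (M \<oplus>\<^bsub>T\<^esub> N)) (x, y) = (\<Oplus>\<^bsub>R\<^esub>z\<in>Z. L (x, z) \<otimes>\<^bsub>R\<^esub> (M \<oplus>\<^bsub>T\<^esub> N) (z, y))"
      by (rule entry[OF add_T_closed[OF M N]])
    also have "\<dots> = (\<Oplus>\<^bsub>R\<^esub>z\<in>Z. L (x, z) \<otimes>\<^bsub>R\<^esub> M (z, y) \<oplus>\<^bsub>R\<^esub> L (x, z) \<otimes>\<^bsub>R\<^esub> N (z, y))"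
      by (rule R.finsum_cong')
        (use closed Z(2) xy in \<open>auto simp: add_T_entry R.r_distr subset_eq\<close>)
    also have "\<dots> = (\<Oplus>\<^bsub>R\<^esub>z\<in>Z. L (x, z) \<otimes>\<^bsub>R\<^esub> M (z, y)) \<oplus>\<^bsub>R\<^esub> (\<Oplus>\<^bsub>R\<^esub>z\<in>Z. L (x, z) \<otimes>\<^bsub>R\<^esub> N (z, y))"
      by (rule R.finsum_addf) (use closed in auto)
    finally show "(L \<otimes>\<^bsub>T\<^esub> (M \<oplus>\<^bsub>T\<^esub> N)) (x, y) = (L \<otimes>\<^bsub>T\<^esub> M \<oplus>\<^bsub>T\<^esub> L \<otimes>\<^bsub>T\<^esub> N) (x, y)"
      by (simp add: add_T_entry xy entry[OF M] entry[OF N])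
  qed (simp_all add: L M N add_T_closed mult_T_closed)
qed

sublocale T: ring T
  by (rule ring_T)

lemma finsum_T_entry:
  assumes "finite J" "\<And>j. j \<in> J \<Longrightarrow> M j \<in> carrier T" and xy: "x \<in> carrier G" "y \<in> carrier G"
  shows "(\<Oplus>\<^bsub>T\<^esub>j\<in>J. M j) (x, y) = (\<Oplus>\<^bsub>R\<^esub>j\<in>J. M j (x, y))"
  using assms(1,2)
proof (induction J rule: finite_induct)
  case empty
  then show ?case
    using xy by (simp add: zero_T_entry)
next
  case (insert k J)
  have "(\<Oplus>\<^bsub>T\<^esub>j\<in>insert k J. M j) = M k \<oplus>\<^bsub>T\<^esub> (\<Oplus>\<^bsub>T\<^esub>j\<in>J. M j)"
    using insert by (intro T.finsum_insert) auto
  moreover have "(\<Oplus>\<^bsub>R\<^esub>j\<in>insert k J. M j (x, y)) = M k (x, y) \<oplus>\<^bsub>R\<^esub> (\<Oplus>\<^bsub>R\<^esub>j\<in>J. M j (x, y))"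
    using insert T_closed[OF _ xy] by (intro R.finsum_insert) auto
  ultimately show ?case
    using insert xy by (simp add: add_T_entry)
qed

section \<open>Factorizations of the identity over the translation ring\<close>

lemma identity_factors_TI:
  assumes "finite Q" and AB: "\<And>p q. p \<in> P \<Longrightarrow> q \<in> Q \<Longrightarrow> A p q \<in> carrier T \<and> B q p \<in> carrier T"
    and entries: "\<And>p p' x y. p \<in> P \<Longrightarrow> p' \<in> P \<Longrightarrow> x \<in> carrier G \<Longrightarrow> y \<in> carrier G \<Longrightarrow>
      (\<Oplus>\<^bsub>R\<^esub>q\<in>Q. (A p q \<otimes>\<^bsub>T\<^esub> B q p') (x, y)) = (if (p, x) = (p', y) then \<one>\<^bsub>R\<^esub> else \<zero>\<^bsub>R\<^esub>)"
  shows "identity_factors T P Q"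
proof -
  have "(\<Oplus>\<^bsub>T\<^esub>q\<in>Q. A p q \<otimes>\<^bsub>T\<^esub> B q p') = (if p = p' then \<one>\<^bsub>T\<^esub> else \<zero>\<^bsub>T\<^esub>)"
    if p: "p \<in> P" "p' \<in> P" for p p'
  proof (rule T_eqI)
    show "(\<Oplus>\<^bsub>T\<^esub>q\<in>Q. A p q \<otimes>\<^bsub>T\<^esub> B q p') \<in> carrier T"
      by (rule T.finsum_closed) (use AB p in auto)
    show "(if p = p' then \<one>\<^bsub>T\<^esub> else \<zero>\<^bsub>T\<^esub>) \<in> carrier T"
      by simp
    fix x y assume xy: "x \<in> carrier G" "y \<in> carrier G"
    have "(\<Oplus>\<^bsub>T\<^esub>q\<in>Q. A p q \<otimes>\<^bsub>T\<^esub> B q p') (x, y) = (\<Oplus>\<^bsub>R\<^esub>q\<in>Q. (A p q \<otimes>\<^bsub>T\<^esub> B q p') (x, y))"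
      by (rule finsum_T_entry[OF assms(1) _ xy]) (use AB p in auto)
    then show "(\<Oplus>\<^bsub>T\<^esub>q\<in>Q. A p q \<otimes>\<^bsub>T\<^esub> B q p') (x, y) = (if p = p' then \<one>\<^bsub>T\<^esub> else \<zero>\<^bsub>T\<^esub>) (x, y)"
      using entries[OF p xy] xy by (simp add: one_T_entry zero_T_entry)
  qed
  then show ?thesis
    unfolding identity_factors_def using AB by blast
qed

text \<open>
  The ring embeds in the translation ring by constant diagonal matrices.
\<close>

lemma identity_factors_scalars:
  assumes "identity_factors R P Q" "finite Q"
  shows "identity_factors T P Q"
proof -
  obtain A B where
    AB: "\<forall>p\<in>P. \<forall>q\<in>Q. A p q \<in> carrier R \<and> B q p \<in> carrier R"
    and one: "\<forall>p\<in>P. \<forall>p'\<in>P. (\<Oplus>\<^bsub>R\<^esub>q\<in>Q. A p q \<otimes>\<^bsub>R\<^esub> B q p') = (if p = p' then \<one>\<^bsub>R\<^esub> else \<zero>\<^bsub>R\<^esub>)"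
    using assms(1) unfolding identity_factors_def by (elim exE conjE) (rule that)
  define scalar where "scalar r = (\<lambda>(x, y)\<in>carrier G \<times> carrier G. if x = y then r else \<zero>\<^bsub>R\<^esub>)" for r
  have scalar: "scalar r \<in> carrier T" if "r \<in> carrier R" for r
    unfolding scalar_def by (rule T_carrierI[of "{\<one>\<^bsub>G\<^esub>}"]) (use that in \<open>auto simp: r_coset_def\<close>)
  have mult: "(scalar r \<otimes>\<^bsub>T\<^esub> scalar s) (x, y) = (if x = y then r \<otimes>\<^bsub>R\<^esub> s else \<zero>\<^bsub>R\<^esub>)"
    if "r \<in> carrier R" "s \<in> carrier R" "x \<in> carrier G" "y \<in> carrier G" for r s x y
    by (subst diagonal_mult_entry[OF scalar scalar]) (use that in \<open>auto simp: scalar_def\<close>)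
  show ?thesis
  proof (rule identity_factors_TI[where A = "\<lambda>p q. scalar (A p q)" and B = "\<lambda>q p. scalar (B q p)"])
    fix p p' x y assume p: "p \<in> P" "p' \<in> P" and xy: "x \<in> carrier G" "y \<in> carrier G"
    have "(\<Oplus>\<^bsub>R\<^esub>q\<in>Q. (scalar (A p q) \<otimes>\<^bsub>T\<^esub> scalar (B q p')) (x, y))
        = (\<Oplus>\<^bsub>R\<^esub>q\<in>Q. if x = y then A p q \<otimes>\<^bsub>R\<^esub> B q p' else \<zero>\<^bsub>R\<^esub>)"
      by (rule R.finsum_cong') (use AB p xy in \<open>auto simp: mult\<close>)
    also have "\<dots> = (if (p, x) = (p', y) then \<one>\<^bsub>R\<^esub> else \<zero>\<^bsub>R\<^esub>)"
      using one p by (cases "x = y") auto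
    finally show "(\<Oplus>\<^bsub>R\<^esub>q\<in>Q. (scalar (A p q) \<otimes>\<^bsub>T\<^esub> scalar (B q p')) (x, y))
        = (if (p, x) = (p', y) then \<one>\<^bsub>R\<^esub> else \<zero>\<^bsub>R\<^esub>)" .
  qed (use assms AB scalar in auto)
qed

text \<open>
  Matrices over the translation ring are matrices over \<open>R\<close> with rows and columns indexed by pairs. Since
  \<open>K\<close> bounds the supports of all entries of the left factor, its rows over \<open>F\<close> are supported in the columns over
  \<open>K F\<close>, so that cutting off the other columns does not change the product.
\<close>

lemma identity_factors_restrict:
  assumes "identity_factors T P Q" "finite P" "finite Q"
  shows "\<exists>K. finite K \<and> K \<subseteq> carrier G \<and>
    (\<forall>F. finite F \<longrightarrow> F \<subseteq> carrier G \<longrightarrow> identity_factors R (P \<times> F) (Q \<times> (K <#>\<^bsub>G\<^esub> F)))"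
proof -
  obtain A B where
    AB: "\<forall>p\<in>P. \<forall>q\<in>Q. A p q \<in> carrier T \<and> B q p \<in> carrier T"
    and one: "\<forall>p\<in>P. \<forall>p'\<in>P. (\<Oplus>\<^bsub>T\<^esub>q\<in>Q. A p q \<otimes>\<^bsub>T\<^esub> B q p') = (if p = p' then \<one>\<^bsub>T\<^esub> else \<zero>\<^bsub>T\<^esub>)"
    using assms(1) unfolding identity_factors_def by (elim exE conjE) (rule that)
  have "\<exists>K. finite K \<and> K \<subseteq> carrier G \<and>
      (\<forall>x\<in>carrier G. \<forall>y\<in>carrier G. y \<notin> K #>\<^bsub>G\<^esub> x \<longrightarrow> A p q (x, y) = \<zero>\<^bsub>R\<^esub>)"
    if "p \<in> P" "q \<in> Q" for p q
    using AB that by (auto simp: carrier_T translation_carrier_def)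
  then obtain L where L: "\<And>p q. p \<in> P \<Longrightarrow> q \<in> Q \<Longrightarrow> finite (L p q) \<and> L p q \<subseteq> carrier G \<and>
      (\<forall>x\<in>carrier G. \<forall>y\<in>carrier G. y \<notin> L p q #>\<^bsub>G\<^esub> x \<longrightarrow> A p q (x, y) = \<zero>\<^bsub>R\<^esub>)"
    by metis
  define K where "K = (\<Union>p\<in>P. \<Union>q\<in>Q. L p q)"
  have K: "finite K" "K \<subseteq> carrier G"
    using L assms(2,3) by (auto simp: K_def)
  have "identity_factors R (P \<times> F) (Q \<times> (K <#>\<^bsub>G\<^esub> F))" if F: "finite F" "F \<subseteq> carrier G" for F
  proof -
    let ?Z = "K <#>\<^bsub>G\<^esub> F"
    have Z: "finite ?Z" "?Z \<subseteq> carrier G"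
      using K F G.setmult_subset_G by (auto simp: set_mult_def)
    define A' where "A' px qz = A (fst px) (fst qz) (snd px, snd qz)" for px qz
    define B' where "B' qz px = B (fst qz) (fst px) (snd qz, snd px)" for qz px
    have closed: "A' px qz \<in> carrier R \<and> B' qz px \<in> carrier R"
      if "px \<in> P \<times> F" "qz \<in> Q \<times> ?Z" for px qz
    proof -
      have "fst px \<in> P" "fst qz \<in> Q" "snd px \<in> carrier G" "snd qz \<in> carrier G"
        using that F Z by auto
      then show ?thesis
        unfolding A'_def B'_def using AB T_closed by blast
    qed
    have "(\<Oplus>\<^bsub>R\<^esub>qz\<in>Q \<times> ?Z. A' px qz \<otimes>\<^bsub>R\<^esub> B' qz py) = (if px = py then \<one>\<^bsub>R\<^esub> else \<zero>\<^bsub>R\<^esub>)"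
      if px: "px \<in> P \<times> F" and py: "py \<in> P \<times> F" for px py
    proof -
      obtain p x where [simp]: "px = (p, x)" by fastforce
      obtain p' y where [simp]: "py = (p', y)" by fastforce
      have pp: "p \<in> P" "p' \<in> P" and xF: "x \<in> F" and xy: "x \<in> carrier G" "y \<in> carrier G"
        using px py F by auto
      have AT: "A p q \<in> carrier T" and BT: "B q p' \<in> carrier T" if "q \<in> Q" for q
        using AB pp that by auto
      have entry: "(A p q \<otimes>\<^bsub>T\<^esub> B q p') (x, y) = (\<Oplus>\<^bsub>R\<^esub>z\<in>?Z. A' px (q, z) \<otimes>\<^bsub>R\<^esub> B' (q, z) py)"
        if q: "q \<in> Q" for q
      proof -
        have "(A p q \<otimes>\<^bsub>T\<^esub> B q p') (x, y) = (\<Oplus>\<^bsub>R\<^esub>z\<in>?Z. A p q (x, z) \<otimes>\<^bsub>R\<^esub> B q p' (z, y))"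
        proof (rule mult_T_entry[OF AT[OF q] BT[OF q] xy Z])
          fix z assume z: "z \<in> carrier G" "z \<notin> ?Z"
          then have "z \<notin> L p q #>\<^bsub>G\<^esub> x"
            using xF pp q by (auto simp: K_def set_mult_def r_coset_def)
          then show "A p q (x, z) = \<zero>\<^bsub>R\<^esub>"
            using L[OF pp(1) q] xy z by blast
        qed
        then show ?thesis
          by (simp add: A'_def B'_def)
      qed
      have "(\<Oplus>\<^bsub>R\<^esub>qz\<in>Q \<times> ?Z. A' px qz \<otimes>\<^bsub>R\<^esub> B' qz py)
          = (\<Oplus>\<^bsub>R\<^esub>q\<in>Q. \<Oplus>\<^bsub>R\<^esub>z\<in>?Z. A' px (q, z) \<otimes>\<^bsub>R\<^esub> B' (q, z) py)"
        by (rule R.finsum_Times[OF assms(3) Z(1)]) (use closed px py in blast)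
      also have "\<dots> = (\<Oplus>\<^bsub>R\<^esub>q\<in>Q. (A p q \<otimes>\<^bsub>T\<^esub> B q p') (x, y))"
        by (rule R.finsum_cong')
          (use entry T_closed[OF T.m_closed[OF AT BT] xy] in auto)
      also have "\<dots> = (\<Oplus>\<^bsub>T\<^esub>q\<in>Q. A p q \<otimes>\<^bsub>T\<^esub> B q p') (x, y)"
        by (rule finsum_T_entry[OF assms(3) _ xy, symmetric]) (use AT BT in auto)
      also have "\<dots> = (if px = py then \<one>\<^bsub>R\<^esub> else \<zero>\<^bsub>R\<^esub>)"
        using one pp xy by (simp add: one_T_entry zero_T_entry)
      finally show ?thesis .
    qed
    then show ?thesis
      unfolding identity_factors_def using closed by blast
  qed
  then show ?thesis
    using K by blast
qed

text \<open>
  The zero-one matrix of the injection times its transpose is the identity; both are banded because the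
  displacement is bounded.
\<close>

lemma compressing_imp_identity_factors:
  assumes "compressing G K n \<phi>"
  shows "identity_factors T {..<n + 1} {..<n}"
proof -
  have K: "finite K" "K \<subseteq> carrier G" and inj: "inj_on \<phi> (carrier G \<times> {..<n + 1})"
    and in_K: "\<And>x i. x \<in> carrier G \<Longrightarrow> i < n + 1 \<Longrightarrow> \<phi> (x, i) \<in> (K #>\<^bsub>G\<^esub> x) \<times> {..<n}"
    using assms by (auto simp: compressing_def)
  define A where "A i j =
    (\<lambda>(x, y)\<in>carrier G \<times> carrier G. if \<phi> (x, i) = (y, j) then \<one>\<^bsub>R\<^esub> else \<zero>\<^bsub>R\<^esub>)" for i j
  define B where "B j i =
    (\<lambda>(y, x)\<in>carrier G \<times> carrier G. if \<phi> (x, i) = (y, j) then \<one>\<^bsub>R\<^esub> else \<zero>\<^bsub>R\<^esub>)" for i j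
  have A: "A i j \<in> carrier T" if "i < n + 1" for i j
    unfolding A_def
  proof (rule T_carrierI[OF K])
    fix x y assume "x \<in> carrier G" "y \<notin> K #>\<^bsub>G\<^esub> x"
    then have "\<phi> (x, i) \<noteq> (y, j)"
      using in_K[of x i] that by auto
    then show "(if \<phi> (x, i) = (y, j) then \<one>\<^bsub>R\<^esub> else \<zero>\<^bsub>R\<^esub>) = \<zero>\<^bsub>R\<^esub>"
      by simp
  qed auto
  have B: "B j i \<in> carrier T" if "i < n + 1" for i j
    unfolding B_def
  proof (rule T_carrierI[of "m_inv G ` K"])
    fix y x assume yx: "y \<in> carrier G" "x \<in> carrier G" "x \<notin> m_inv G ` K #>\<^bsub>G\<^esub> y"
    have "\<phi> (x, i) \<noteq> (y, j)"
    proof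
      assume "\<phi> (x, i) = (y, j)"
      then have "y \<in> K #>\<^bsub>G\<^esub> x"
        using in_K[OF yx(2) that] by simp
      then obtain k where k: "k \<in> K" "y = k \<otimes>\<^bsub>G\<^esub> x"
        by (auto simp: r_coset_def)
      then have "x = inv\<^bsub>G\<^esub> k \<otimes>\<^bsub>G\<^esub> y"
        using K yx by (simp add: G.inv_solve_left subset_eq)
      then show False
        using k yx by (auto simp: r_coset_def)
    qed
    then show "(if \<phi> (x, i) = (y, j) then \<one>\<^bsub>R\<^esub> else \<zero>\<^bsub>R\<^esub>) = \<zero>\<^bsub>R\<^esub>"
      by simp
  qed (use K in auto)
  \<comment> \<open>Row \<open>(i, x)\<close> of the first factor has its only nonzero entry in the column given by \<open>\<phi> (x, i)\<close>.\<close>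
  show ?thesis
  proof (rule identity_factors_TI[where A = A and B = B])
    fix i i' x y assume "i \<in> {..<n + 1}" "i' \<in> {..<n + 1}"
      and xy: "x \<in> carrier G" "y \<in> carrier G"
    then have i: "i < n + 1" "i' < n + 1" by simp_all
    let ?Z = "K #>\<^bsub>G\<^esub> x"
    obtain z0 j0 where \<phi>x: "\<phi> (x, i) = (z0, j0)" by fastforce
    have zj: "z0 \<in> ?Z" "j0 \<in> {..<n}"
      using in_K[OF xy(1) i(1)] \<phi>x by auto
    have Z: "finite ?Z" "?Z \<subseteq> carrier G"
      using K xy G.r_coset_subset_G by (auto simp: r_coset_def)
    have entry: "(A i j \<otimes>\<^bsub>T\<^esub> B j i') (x, y) = (\<Oplus>\<^bsub>R\<^esub>z\<in>?Z. A i j (x, z) \<otimes>\<^bsub>R\<^esub> B j i' (z, y))" for j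
      by (rule mult_T_entry[OF A[OF i(1)] B[OF i(2)] xy Z])
        (use zj(1) \<phi>x xy in \<open>auto simp: A_def\<close>)
    have closed: "A i j (x, z) \<otimes>\<^bsub>R\<^esub> B j i' (z, y) \<in> carrier R" if "z \<in> ?Z" for j z
      using T_closed[OF A[OF i(1)] xy(1)] T_closed[OF B[OF i(2)] _ xy(2)] that Z by auto
    have "(\<Oplus>\<^bsub>R\<^esub>j\<in>{..<n}. (A i j \<otimes>\<^bsub>T\<^esub> B j i') (x, y))
        = (\<Oplus>\<^bsub>R\<^esub>p\<in>{..<n} \<times> ?Z. A i (fst p) (x, snd p) \<otimes>\<^bsub>R\<^esub> B (fst p) i' (snd p, y))"
      unfolding entry by (subst R.finsum_Times) (use Z closed in auto)
    also have "\<dots> = A i (fst (j0, z0)) (x, snd (j0, z0)) \<otimes>\<^bsub>R\<^esub> B (fst (j0, z0)) i' (snd (j0, z0), y)"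
    proof (rule R.finsum_single)
      fix p assume p: "p \<in> {..<n} \<times> ?Z" "p \<noteq> (j0, z0)"
      then have "snd p \<in> carrier G"
        using Z by auto
      moreover from this have "A i (fst p) (x, snd p) = \<zero>\<^bsub>R\<^esub>"
        using p(2) xy \<phi>x by (auto simp: A_def prod_eq_iff)
      ultimately show "A i (fst p) (x, snd p) \<otimes>\<^bsub>R\<^esub> B (fst p) i' (snd p, y) = \<zero>\<^bsub>R\<^esub>"
        using T_closed[OF B[OF i(2)] _ xy(2)] by simp
    qed (use Z zj closed in auto)
    also have "\<dots> = (if \<phi> (y, i') = \<phi> (x, i) then \<one>\<^bsub>R\<^esub> else \<zero>\<^bsub>R\<^esub>)"
      using zj Z xy \<phi>x by (auto simp: A_def B_def)
    also have "\<dots> = (if (i, x) = (i', y) then \<one>\<^bsub>R\<^esub> else \<zero>\<^bsub>R\<^esub>)"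
      using inj_on_eq_iff[OF inj, of "(y, i')" "(x, i)"] i xy by auto
    finally show "(\<Oplus>\<^bsub>R\<^esub>j\<in>{..<n}. (A i j \<otimes>\<^bsub>T\<^esub> B j i') (x, y))
        = (if (i, x) = (i', y) then \<one>\<^bsub>R\<^esub> else \<zero>\<^bsub>R\<^esub>)" .
  qed (use A B in auto)
qed

lemma UGN_ring_if_UGN_translation_ring:
  assumes "UGN T"
  shows "UGN R"
  using assms identity_factors_scalars
  unfolding UGN_iff_not_identity_factors[OF ring_T] UGN_iff_not_identity_factors[OF R.ring_axioms]
  by blast

text \<open>
  If expansion failed at \<open>F\<close>, restriction to \<open>F\<close> would factor the identity of size \<open>m + 1 = (n + 1) * card F\<close>
  over \<open>R\<close> through size \<open>m\<close>.
\<close>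

lemma expanding_if_not_UGN_translation_ring:
  assumes "UGN R" "\<not> UGN T"
  shows "\<exists>K n. expanding G K n"
proof -
  obtain n :: nat where n: "n > 0" "identity_factors T {..<n + 1} {..<n}"
    using assms(2) UGN_iff_not_identity_factors[OF ring_T] by blast
  then obtain K where K: "finite K" "K \<subseteq> carrier G"
    and restrict: "\<And>F. finite F \<Longrightarrow> F \<subseteq> carrier G \<Longrightarrow>
      identity_factors R ({..<n + 1} \<times> F) ({..<n} \<times> (K <#>\<^bsub>G\<^esub> F))"
    using identity_factors_restrict by (metis finite_lessThan)
  have "(n + 1) * card F \<le> n * card (K <#>\<^bsub>G\<^esub> F)" if F: "finite F" "F \<subseteq> carrier G" for F
  proof (rule ccontr)
    assume "\<not> (n + 1) * card F \<le> n * card (K <#>\<^bsub>G\<^esub> F)"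
    then have less: "n * card (K <#>\<^bsub>G\<^esub> F) < (n + 1) * card F" by simp
    then have "card F \<ge> 1"
      by (cases "card F") auto
    then have "(n + 1) * 1 \<le> (n + 1) * card F"
      by (rule mult_le_mono2)
    then have "(n + 1) * card F > 1"
      by (rule less_le_trans[rotated]) (use n(1) in simp)
    then obtain k where k: "(n + 1) * card F = Suc (1 + k)"
      using less_imp_Suc_add by blast
    \<comment> \<open>Here \<open>F\<close> is nonempty and \<open>n > 0\<close>, so that \<open>(n + 1) * card F \<ge> 2\<close> and \<open>m\<close> is positive.\<close>
    define m where "m = k + 1"
    have m: "m > 0" "m + 1 = (n + 1) * card F"
      unfolding m_def k by simp_all
    have m': "n * card (K <#>\<^bsub>G\<^esub> F) \<le> m"
      using less by (simp only: flip: m(2))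
    have "identity_factors R {..<m + 1} {..<m}"
    proof (rule identity_factors_mono[OF R.ring_axioms restrict[OF F]])
      show "finite ({..<n} \<times> (K <#>\<^bsub>G\<^esub> F))"
        using K F by (auto simp: set_mult_def)
      show "card {..<m + 1} \<le> card ({..<n + 1} \<times> F)"
        using m(2) by (simp add: card_cartesian_product)
      show "card ({..<n} \<times> (K <#>\<^bsub>G\<^esub> F)) \<le> card {..<m}"
        using m' by (simp add: card_cartesian_product)
    qed (use F in auto)
    then show False
      using assms(1) m(1) UGN_iff_not_identity_factors[OF R.ring_axioms] by blast
  qed
  then have "expanding G K n"
    using K by (simp add: expanding_def)
  then show ?thesis
    by blast
qed

end

section \<open>Amenability and the translation ring\<close>

theorem corollary3p5:
  fixes G :: "('g, 'b) monoid_scheme"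
  assumes "group G"
    and "infinite (UNIV :: 'r set)"
  shows "amenable G \<longleftrightarrow>
    (\<forall>R :: 'r ring. ring R \<longrightarrow> (UGN (translation_ring G R) \<longleftrightarrow> UGN R))"
proof
  assume amenable: "amenable G"
  show "\<forall>R :: 'r ring. ring R \<longrightarrow> (UGN (translation_ring G R) \<longleftrightarrow> UGN R)"
  proof (intro allI impI)
    fix R :: "'r ring" assume "ring R"
    then interpret group_and_ring G R
      using assms(1) by (simp add: group_and_ring_def)
    have "\<not> expanding G K n" for K n
      using amenable expanding_imp_compressing compressing_not_amenable[OF assms(1)] by blast
    then show "UGN (translation_ring G R) \<longleftrightarrow> UGN R"
      using UGN_ring_if_UGN_translation_ring expanding_if_not_UGN_translation_ring by blast
  qed
next
  assume ring_iff: "\<forall>R :: 'r ring. ring R \<longrightarrow> (UGN (translation_ring G R) \<longleftrightarrow> UGN R)"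
  show "amenable G"
  proof (rule ccontr)
    assume "\<not> amenable G"
    then obtain K n where n: "n > 0" "expanding G K n"
      using not_expanding_imp_amenable[OF assms(1)] by blast
    then obtain \<phi> where \<phi>: "compressing G K n \<phi>"
      using expanding_imp_compressing by blast
    obtain a b :: 'r where ab: "a \<noteq> b"
      using ex_new_if_finite[OF assms(2), of "{undefined}"] by auto
    let ?R = "two_element_ring a b"
    interpret group_and_ring G ?R
      using assms(1) ring_two_element_ring[OF ab] by (simp add: group_and_ring_def)
    have "\<not> UGN (translation_ring G ?R)"
      using compressing_imp_identity_factors[OF \<phi>] n(1) UGN_iff_not_identity_factors[OF ring_T] by blast
    then show False
      using ring_iff ring_two_element_ring[OF ab] UGN_two_element_ring[OF ab] by blast
  qed
qed

end
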